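(* For every $d\ge 1$, the following three sets are pairwise in bijection (equivalently, have the same cardinality): (i) the set of binary de Bruijn words of order $d+1$; (ii) the set of binary necklaces of length $2^d$ having an odd number of $1$'s; (iii) the set of unordered normal bases of $\mathrm{GF}_{2^{2^d}}$ over $\mathrm{GF}_2$.
   Context: A necklace is the set of rotations (conjugacy class) of a word. A binary de Bruijn word of order $m$ is a necklace of length $2^m$ over $\{0,1\}$ in which each of the $2^m$ binary words of length $m$ occurs exactly once as a cyclic factor. A normal basis of $\mathrm{GF}_{2^N}$ is a basis over $\mathrm{GF}_2$ of the form $\{\gamma,\gamma^2,\gamma^4,\ldots,\gamma^{2^{N-1}}\}$. *)

theory Defs
  imports "HOL-Algebra.Algebra"
begin

definition necklace :: "'a list \<Rightarrow> 'a list set" where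
  "necklace w = {rotate k w | k. True}"

text \<open>Binary words are \<^typ>\<open>bool list\<close>s, with \<^const>\<open>True\<close> standing for the letter 1.\<close>

definition cyclic_factor :: "'a list \<Rightarrow> nat \<Rightarrow> nat \<Rightarrow> 'a list" where
  "cyclic_factor w i m = map (\<lambda>j. w ! ((i + j) mod length w)) [0..<m]"

definition is_de_bruijn :: "nat \<Rightarrow> bool list \<Rightarrow> bool" where
  "is_de_bruijn m w \<longleftrightarrow>
     length w = 2 ^ m \<and>
     (\<forall>u :: bool list. length u = m \<longrightarrow> (\<exists>!i. i < length w \<and> cyclic_factor w i m = u))"

text \<open>The next two definitions are by representatives: being de Bruijn and the
  number of 1's are invariant under rotation.\<close>

definition de_bruijn_words :: "nat \<Rightarrow> bool list set set" where
  "de_bruijn_words m = necklace ` {w. is_de_bruijn m w}"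

definition odd_necklaces :: "nat \<Rightarrow> bool list set set" where
  "odd_necklaces n = necklace ` {w. length w = n \<and> odd (count_list w True)}"

definition frobenius_orbit :: "('a, 'b) ring_scheme \<Rightarrow> nat \<Rightarrow> 'a \<Rightarrow> 'a list" where
  "frobenius_orbit F N \<gamma> = map (\<lambda>i. \<gamma> [^]\<^bsub>F\<^esub> ((2 :: nat) ^ i)) [0..<N]"

text \<open>Intended for a field \<open>F\<close> with \<open>2 ^ N\<close> elements, whose prime subfield (the copy of the
  two-element field inside \<open>F\<close>) is \<open>{\<zero>, \<one>}\<close>. A normal basis is kept as a set, hence unordered;
  \<open>ring.independent\<close> forces the \<open>N\<close> listed elements to be distinct.\<close>

definition normal_bases :: "('a, 'b) ring_scheme \<Rightarrow> nat \<Rightarrow> 'a set set" where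
  "normal_bases F N =
     {set (frobenius_orbit F N \<gamma>) | \<gamma>.
        \<gamma> \<in> carrier F \<and>
        ring.independent F {\<zero>\<^bsub>F\<^esub>, \<one>\<^bsub>F\<^esub>} (frobenius_orbit F N \<gamma>) \<and>
        ring.Span F {\<zero>\<^bsub>F\<^esub>, \<one>\<^bsub>F\<^esub>} (frobenius_orbit F N \<gamma>) = carrier F}"

end

theory Submission
  imports Defs "Jordan_Normal_Form.Char_Poly"
begin

text \<open>
  All three sets have \<open>2 ^ (2 ^ d - d - 1)\<close> elements.

  A de Bruijn word of order \<open>d + 1\<close> is a cyclic permutation of the words of length \<open>d + 1\<close> that sends
  every \<open>a # u\<close> to some \<open>u @ [b]\<close>. Shift permutations of this kind correspond to subsets of
  the \<open>N = 2 ^ d\<close> words \<open>u\<close>, and being cyclic is detected by the determinant of the identity minus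
  the permutation matrix, with one row replaced by a unit vector. The two rows affected by the
  choice at \<open>u\<close> make this determinant affine in that choice, so the sum over all
  choices is \<open>2 ^ N\<close> times the determinant of the averaged matrix, which belongs to the random walk
  on the de Bruijn graph and equals \<open>1 / (2 * N)\<close>.

  A cyclic group of order \<open>2 ^ d\<close> acts freely as soon as its involution has no fixed point. This
  applies to rotation on words with an odd number of ones, and to the Frobenius map \<open>\<phi>\<close> on
  generators of normal bases: as \<open>(1 + \<phi>) ^ N = 1 + \<phi> ^ N = 0\<close>, these generators are the elements not
  killed by \<open>(1 + \<phi>) ^ (N - 1)\<close>, which are half of the field.
\<close>

hide_const (open) Polynomial.order

subsection \<open>Determinants of weighted shifts\<close>

lemma mult_mat_vec_index:
  assumes "i < n"
  shows "(mat n n (\<lambda>(i, j). a i j) *\<^sub>v vec n x) $ i = (\<Sum>j<n. a i j * x j :: 'a :: comm_semiring_0)"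
  using assms by (simp add: scalar_prod_def lessThan_atLeast0)

text \<open>The hypothesis says that 0 is the only eigenvalue. Over the complex numbers the
  characteristic polynomial splits into linear factors, so it is \<open>X ^ n\<close>, and the
  determinant is its value at 1.\<close>

lemma det_one_minus_eq_1:
  fixes r :: "nat \<Rightarrow> nat \<Rightarrow> complex"
  assumes "\<And>x l i. \<lbrakk>l \<noteq> 0; \<And>i. i < n \<Longrightarrow> (\<Sum>j<n. r i j * x j) = l * x i; i < n\<rbrakk> \<Longrightarrow> x i = 0"
  shows "det (mat n n (\<lambda>(i, j). (if i = j then 1 else 0) - r i j)) = 1"
proof -
  define A where "A = mat n n (\<lambda>(i, j). r i j)"
  have A: "A \<in> carrier_mat n n"
    by (simp add: A_def)
  obtain as where as: "char_poly A = (\<Prod>a\<leftarrow>as. [:- a, 1:])" "length as = n"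
    using char_poly_factorized[OF A] by blast
  have eig0: "a = 0" if "a \<in> set as" for a
  proof (rule ccontr)
    assume "a \<noteq> 0"
    have "poly (char_poly A) a = 0"
      using that unfolding as(1) by (induction as) auto
    then have "eigenvalue A a"
      using eigenvalue_root_char_poly[OF A] by blast
    then obtain v where v: "v \<in> carrier_vec n" "v \<noteq> 0\<^sub>v n" "A *\<^sub>v v = a \<cdot>\<^sub>v v"
      using A unfolding eigenvalue_def eigenvector_def by auto
    have veq: "v = vec n (($) v)"
      using v(1) by auto
    have "(\<Sum>j<n. r i j * v $ j) = a * v $ i" if "i < n" for i
      using arg_cong[OF v(3), of "\<lambda>w. w $ i"] mult_mat_vec_index[OF that, of r "($) v"]
        that v(1) veq by (simp add: A_def)
    then have "\<And>i. i < n \<Longrightarrow> v $ i = 0"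
      using assms[OF \<open>a \<noteq> 0\<close>] by blast
    then show False
      using v(1,2) by auto
  qed
  have "poly (char_poly A) 1 = 1"
    using eig0 unfolding as(1) by (induction as) auto
  moreover have "poly (char_poly A) 1 = det (mat n n (\<lambda>(i, j). (if i = j then 1 else 0) - r i j))"
    unfolding char_poly_def
    by (rule poly_det_cong[of _ n]) (auto simp: A_def char_poly_matrix_def)
  ultimately show ?thesis
    by simp
qed

lemma det_eq_0_if_kernel:
  fixes a :: "nat \<Rightarrow> nat \<Rightarrow> 'a :: idom"
  assumes "\<And>i. i < n \<Longrightarrow> (\<Sum>j<n. a i j * x j) = 0" and "k < n" "x k \<noteq> 0"
  shows "det (mat n n (\<lambda>(i, j). a i j)) = 0"
proof -
  have "mat n n (\<lambda>(i, j). a i j) *\<^sub>v vec n x = 0\<^sub>v n"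
    using assms(1) mult_mat_vec_index[of _ n a x] by (intro eq_vecI) auto
  moreover have "vec n x \<noteq> 0\<^sub>v n"
    using assms(2,3) by (metis index_vec index_zero_vec(1))
  ultimately show ?thesis
    by (subst det_0_iff_vec_prod_zero[of _ n]) (auto intro: exI[of _ "vec n x"])
qed

text \<open>In the Laplace expansion along row \<open>k\<close> the cofactors do not see
  \<open>p\<close>, and the entries of that row are affine in \<open>p\<close>.\<close>

lemma det_affine_in_row:
  fixes a :: "nat \<Rightarrow> nat \<Rightarrow> 'a :: comm_ring_1"
  assumes "k < n"
  shows "\<exists>\<alpha> \<beta>. \<forall>p. det (mat n n (\<lambda>(i, j). if i = k then u j + p * c j else a i j)) = \<alpha> + p * \<beta>"
proof -
  define B where "B p = mat n n (\<lambda>(i, j). if i = k then u j + p * c j else a i j)" for p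
  have "mat_delete (B p) k j = mat_delete (B 0) k j" for p j
    by (rule eq_matI) (auto simp: mat_delete_def B_def)
  then have cof: "cofactor (B p) k j = cofactor (B 0) k j" for p j
    unfolding cofactor_def by metis
  have "det (B p) = (\<Sum>j<n. B p $$ (k, j) * cofactor (B p) k j)" for p
    by (rule laplace_expansion_row) (auto simp: B_def assms)
  also have "\<dots> p = (\<Sum>j<n. u j * cofactor (B 0) k j) + p * (\<Sum>j<n. c j * cofactor (B 0) k j)" for p
    unfolding cof[of p] sum_distrib_left sum.distrib[symmetric]
    by (rule sum.cong) (auto simp: B_def assms algebra_simps)
  finally show ?thesis
    unfolding B_def by blast
qed

lemma det_add_row:
  fixes a :: "nat \<Rightarrow> nat \<Rightarrow> 'a :: comm_ring_1"
  assumes "k \<noteq> l" "k < n" "l < n"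
  shows "det (mat n n (\<lambda>(i, j). if i = k then a k j + a l j else a i j)) = det (mat n n (\<lambda>(i, j). a i j))"
proof -
  have "mat n n (\<lambda>(i, j). if i = k then a k j + a l j else a i j) = addrow 1 k l (mat n n (\<lambda>(i, j). a i j))"
    by (rule eq_matI) (use assms in auto)
  then show ?thesis
    using det_addrow[OF assms(3,1), of "mat n n (\<lambda>(i, j). a i j)" 1] by simp
qed

text \<open>Adding row \<open>l\<close> to row \<open>k\<close> removes \<open>p\<close> from row \<open>k\<close>: there is no quadratic term.\<close>

lemma det_affine_in_opposite_rows:
  fixes a :: "nat \<Rightarrow> nat \<Rightarrow> 'a :: comm_ring_1"
  assumes kl: "k \<noteq> l" "k < n" "l < n"
  shows "\<exists>\<alpha> \<beta>. \<forall>p. det (mat n n (\<lambda>(i, j). if i = k then u j - p * c j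
    else if i = l then w j + p * c j else a i j)) = \<alpha> + p * \<beta>"
proof -
  define b where "b p i j = (if i = k then u j - p * c j
    else if i = l then w j + p * c j else a i j)" for p i j
  define a' where "a' i j = (if i = k then u j + w j else a i j)" for i j
  obtain \<alpha> \<beta> where *: "\<And>p. det (mat n n (\<lambda>(i, j). if i = l then w j + p * c j else a' i j)) = \<alpha> + p * \<beta>"
    using det_affine_in_row[OF kl(3), of w c a'] by blast
  have "det (mat n n (\<lambda>(i, j). b p i j)) = \<alpha> + p * \<beta>" for p
  proof -
    have "det (mat n n (\<lambda>(i, j). b p i j))
        = det (mat n n (\<lambda>(i, j). if i = k then b p k j + b p l j else b p i j))"
      by (rule det_add_row[OF kl, symmetric])
    also have "(\<lambda>(i, j). if i = k then b p k j + b p l j else b p i j)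
        = (\<lambda>(i, j). if i = l then w j + p * c j else a' i j)"
      using kl by (auto simp: fun_eq_iff b_def a'_def)
    finally show ?thesis
      using * by simp
  qed
  then show ?thesis
    unfolding b_def by blast
qed

text \<open>Numbers below \<open>2 * N\<close> with \<open>N = 2 ^ d\<close> stand for the words of length \<open>d + 1\<close>, most significant
  letter first; \<open>v\<close> and \<open>v + N\<close> have the same two successors \<open>2 * v\<close> and \<open>2 * v + 1\<close>. The state \<open>v\<close>
  moves to \<open>2 * v + 1\<close> with weight \<open>p v\<close>, and \<open>v + N\<close> moves there with the complementary weight, so
  that the values 0 and 1 of \<open>p\<close> give permutations and \<open>1 / 2\<close> gives the random walk.\<close>

definition shift_weight :: "nat \<Rightarrow> (nat \<Rightarrow> complex) \<Rightarrow> nat \<Rightarrow> nat \<Rightarrow> complex" where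
  "shift_weight N p i j =
     (if j = 2 * (i mod N) then (if i < N then 1 - p (i mod N) else p (i mod N))
      else if j = 2 * (i mod N) + 1 then (if i < N then p (i mod N) else 1 - p (i mod N))
      else 0)"

text \<open>Row 0 is replaced by a unit vector: for a permutation, the determinant is then 1 if there is
  a single cycle, and 0 otherwise.\<close>

definition rooted_laplacian :: "nat \<Rightarrow> (nat \<Rightarrow> complex) \<Rightarrow> complex mat" where
  "rooted_laplacian N p = mat (2 * N) (2 * N) (\<lambda>(i, j).
     (if i = j then 1 else 0) - (if i = 0 then 0 else shift_weight N p i j))"

text \<open>The weight at \<open>v\<close> enters only rows \<open>v\<close> and
  \<open>v + N\<close>, with opposite signs. For \<open>v = 0\<close> the first of these rows has
  been overwritten, so a single row depends on \<open>t\<close>.\<close>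

lemma det_rooted_laplacian_affine:
  assumes "v < N"
  shows "\<exists>\<alpha> \<beta>. \<forall>t. det (rooted_laplacian N (p(v := t))) = \<alpha> + t * \<beta>"
proof -
  \<comment> \<open>Raising \<open>t\<close> moves weight between columns \<open>2 * v\<close> and
    \<open>2 * v + 1\<close>; \<open>c\<close> is this change in row \<open>v + N\<close>, up to the
    weight 1 that is moved.\<close>
  define c where "c j = (if j = 2 * v then - 1 else if j = 2 * v + 1 then 1 else 0 :: complex)" for j
  define L where "L t i j = (if i = j then 1 else 0)
    - (if i = 0 then 0 else shift_weight N (p(v := t)) i j)" for t i j
  have other: "L t i j = L 0 i j" if "i mod N \<noteq> v" for t i j
    using that assms by (cases "i = v") (simp_all add: L_def shift_weight_def)
  have rowN: "L t (v + N) j = L 0 (v + N) j + t * c j" for t j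
    using assms by (auto simp: L_def shift_weight_def c_def)
  have row: "L t v j = L 0 v j - t * c j" if "v \<noteq> 0" for t j
    using assms that by (auto simp: L_def shift_weight_def c_def)
  have row0: "L t 0 j = L 0 0 j" for t j
    by (simp add: L_def)
  have mod: "i mod N = v \<longleftrightarrow> i = v \<or> i = v + N" if "i < 2 * N" for i
    using that assms by (cases "i < N") (auto simp: mod_if)
  show ?thesis
  proof (cases "v = 0")
    case True
    have "L t i j = (if i = v + N then L 0 (v + N) j + t * c j else L 0 i j)" if "i < 2 * N" for t i j
      using rowN[of t j] row0[of t j] other[of i t j] mod[OF that] True assms
      by (cases "i = v"; cases "i = v + N") simp_all
    then have "rooted_laplacian N (p(v := t))
      = mat (2 * N) (2 * N) (\<lambda>(i, j). if i = v + N then L 0 (v + N) j + t * c j else L 0 i j)" for t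
      unfolding rooted_laplacian_def L_def[symmetric] by (intro eq_matI) simp_all
    then show ?thesis
      using det_affine_in_row[of "v + N" "2 * N" "L 0 (v + N)" c "L 0"] assms by simp
  next
    case False
    have "L t i j = (if i = v then L 0 v j - t * c j
        else if i = v + N then L 0 (v + N) j + t * c j else L 0 i j)" if "i < 2 * N" for t i j
      using rowN[of t j] row[OF False, of t j] other[of i t j] mod[OF that] assms
      by (cases "i = v"; cases "i = v + N") simp_all
    then have "rooted_laplacian N (p(v := t))
      = mat (2 * N) (2 * N) (\<lambda>(i, j). if i = v then L 0 v j - t * c j
          else if i = v + N then L 0 (v + N) j + t * c j else L 0 i j)" for t
      unfolding rooted_laplacian_def L_def[symmetric] by (intro eq_matI) simp_all
    then show ?thesis
      using det_affine_in_opposite_rows[of v "v + N" "2 * N" "L 0 v" c "L 0 (v + N)" "L 0"] assms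
      by simp
  qed
qed

text \<open>Choices inside \<open>S\<close> are summed over, those outside are already averaged.
  Each induction step averages one more choice: the values of an affine function at 0 and 1 add up
  to twice its value at \<open>1 / 2\<close>.\<close>

lemma sum_det_rooted_laplacian:
  assumes "S \<subseteq> {..<N}"
  shows "(\<Sum>T\<in>Pow S. det (rooted_laplacian N
      (\<lambda>v. if v \<in> T then 1 else if v \<in> S then 0 else 1 / 2)))
    = 2 ^ card S * det (rooted_laplacian N (\<lambda>v. 1 / 2))"
proof -
  have "finite S"
    using assms finite_subset by blast
  then show ?thesis
    using assms
  proof (induction S)
    case empty
    show ?case
      by simp
  next
    case (insert v S)
    define P where "P S T = (\<lambda>u. if u \<in> T then 1 else if u \<in> S then 0 else 1 / 2 :: complex)"
      for S T :: "nat set"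
    let ?D = "\<lambda>S T. det (rooted_laplacian N (P S T))"
    have two: "?D (insert v S) T + ?D (insert v S) (insert v T) = 2 * ?D S T" if "T \<in> Pow S" for T
    proof -
      have "v \<notin> T"
        using that insert.hyps by blast
      then have "P (insert v S) T = (P S T)(v := 0)" "P (insert v S) (insert v T) = (P S T)(v := 1)"
        "P S T = (P S T)(v := 1 / 2)"
        using insert.hyps by (auto simp: P_def fun_eq_iff)
      moreover obtain \<alpha> \<beta> where "\<And>t. det (rooted_laplacian N ((P S T)(v := t))) = \<alpha> + t * \<beta>"
        using det_rooted_laplacian_affine[of v N "P S T"] insert.prems by blast
      moreover have "(\<alpha> + 0 * \<beta>) + (\<alpha> + 1 * \<beta>) = 2 * (\<alpha> + 1 / 2 * \<beta>)"
        by simp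
      ultimately show ?thesis
        by metis
    qed
    have "(\<Sum>T\<in>Pow (insert v S). ?D (insert v S) T)
        = (\<Sum>T\<in>Pow S. ?D (insert v S) T) + (\<Sum>T\<in>insert v ` Pow S. ?D (insert v S) T)"
      unfolding Pow_insert using insert.hyps by (intro sum.union_disjoint) auto
    also have "(\<Sum>T\<in>insert v ` Pow S. ?D (insert v S) T) = (\<Sum>T\<in>Pow S. ?D (insert v S) (insert v T))"
      by (rule sum.reindex_cong[OF _ refl refl])
        (use insert.hyps in \<open>auto simp: inj_on_def dest: insert_ident[THEN iffD1, rotated 2]\<close>)
    also have "(\<Sum>T\<in>Pow S. ?D (insert v S) T) + \<dots> = (\<Sum>T\<in>Pow S. 2 * ?D S T)"
      unfolding sum.distrib[symmetric] using two by (intro sum.cong) auto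
    also have "\<dots> = 2 ^ card (insert v S) * det (rooted_laplacian N (\<lambda>v. 1 / 2))"
      using insert by (simp add: P_def sum_distrib_left[symmetric])
    finally show ?case
      by (simp only: P_def)
  qed
qed


text \<open>The map given by 0-1 weights: \<open>T\<close> collects the \<open>v < N\<close> that go
  to \<open>2 * v + 1\<close>, and \<open>v + N\<close> takes the successor left over by
  \<open>v\<close>.\<close>

definition shift_step :: "nat \<Rightarrow> nat set \<Rightarrow> nat \<Rightarrow> nat" where
  "shift_step N T v = 2 * (v mod N) + of_bool ((v mod N \<in> T) \<noteq> (N \<le> v))"

lemma shift_step_less:
  assumes "v < 2 * N"
  shows "shift_step N T v < 2 * N"
proof -
  have "v mod N < N"
    using assms by simp
  moreover have "shift_step N T v \<le> 2 * (v mod N) + 1"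
    by (simp add: shift_step_def)
  ultimately show ?thesis
    by linarith
qed

lemma shift_weight_of_bool:
  "shift_weight N (\<lambda>v. of_bool (v \<in> T)) i j = of_bool (j = shift_step N T i)"
  by (auto simp: shift_weight_def shift_step_def not_le)

text \<open>With row 0 cut, an eigenvector for a nonzero eigenvalue vanishes at 0 and hence, going
  backwards along the paths, at all states that reach 0. If some state never reaches 0, the
  indicator of all such states is a kernel vector.\<close>

lemma det_rooted_laplacian_shift_step:
  assumes "0 < N"
  shows "det (rooted_laplacian N (\<lambda>v. of_bool (v \<in> T)))
    = of_bool (\<forall>v<2 * N. \<exists>k. (shift_step N T ^^ k) v = 0)"
proof (cases "\<forall>v<2 * N. \<exists>k. (shift_step N T ^^ k) v = 0")
  case True
  define r where "r i j = (if i = 0 then 0 else of_bool (j = shift_step N T i) :: complex)" for i j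
  have "det (mat (2 * N) (2 * N) (\<lambda>(i, j). (if i = j then 1 else 0) - r i j)) = 1"
  proof (rule det_one_minus_eq_1)
    fix x l i
    assume l: "l \<noteq> 0" and eig: "\<And>i. i < 2 * N \<Longrightarrow> (\<Sum>j<2 * N. r i j * x j) = l * x i"
      and i: "i < 2 * N"
    have x0: "x 0 = 0"
      using eig[of 0] assms l by (simp add: r_def)
    have step: "x (shift_step N T i) = l * x i" if "i < 2 * N" "i \<noteq> 0" for i
      using eig[OF that(1)] that shift_step_less[OF that(1), of T] by (simp add: r_def)
    have "x i = 0" if "(shift_step N T ^^ k) i = 0" "i < 2 * N" for k i
      using that
    proof (induction k arbitrary: i)
      case (Suc k)
      then have "x (shift_step N T i) = 0"
        using shift_step_less by (simp add: funpow_swap1)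
      then show ?case
        using step[OF Suc.prems(2)] x0 l by (cases "i = 0") auto
    qed (simp add: x0)
    then show "x i = 0"
      using True i by blast
  qed
  then show ?thesis
    using True by (simp add: rooted_laplacian_def shift_weight_of_bool r_def cong: if_cong)
next
  case False
  then obtain v where v: "v < 2 * N" "\<And>k. (shift_step N T ^^ k) v \<noteq> 0"
    by metis
  define x where "x i = (of_bool (\<forall>k. (shift_step N T ^^ k) i \<noteq> 0) :: complex)" for i
  have x0: "x 0 = 0"
    unfolding x_def by (auto intro: exI[of _ 0])
  have xs: "x (shift_step N T i) = x i" if "i \<noteq> 0" for i
  proof -
    have "(\<forall>k. (shift_step N T ^^ k) i \<noteq> 0) \<longleftrightarrow> (\<forall>k. (shift_step N T ^^ Suc k) i \<noteq> 0)"
      using that by (metis funpow_0 not0_implies_Suc)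
    then show ?thesis
      unfolding x_def by (simp only: funpow_Suc_right comp_apply)
  qed
  have "det (rooted_laplacian N (\<lambda>v. of_bool (v \<in> T))) = 0"
    unfolding rooted_laplacian_def
  proof (rule det_eq_0_if_kernel)
    fix i assume i: "i < 2 * N"
    show "(\<Sum>j<2 * N. ((if i = j then 1 else 0)
      - (if i = 0 then 0 else shift_weight N (\<lambda>v. of_bool (v \<in> T)) i j)) * x j) = 0"
      using i x0 xs[of i] shift_step_less[OF i, of T]
      by (cases "i = 0") (simp_all add: shift_weight_of_bool left_diff_distrib sum_subtractf
          if_distrib[of "\<lambda>y. y * _"] cong: if_cong)
  next
    show "x v \<noteq> 0"
      using v(2) by (simp add: x_def)
  qed (rule v(1))
  then show ?thesis
    using False by simp
qed

lemma sum_lessThan_double: "(\<Sum>c<2 * m. f c) = (\<Sum>c<m. f (2 * c) + f (2 * c + 1 :: nat) :: 'a :: comm_monoid_add)"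
  by (induction m) (simp_all add: add.assoc)

text \<open>Subtracting 1 from all entries of row 0 of the random walk matrix makes it nilpotent: the
  column sums become 0, and \<open>d + 1\<close> steps of the walk average over all states. Summing the columns
  of the identity minus this matrix into column 0 leaves \<open>2 * N\<close> times the required minor.\<close>

lemma det_rooted_laplacian_half:
  fixes d :: nat
  defines "N \<equiv> 2 ^ d"
  shows "of_nat (2 * N) * det (rooted_laplacian N (\<lambda>v. 1 / 2)) = 1"
proof -
  define n where "n = 2 * N"
  have N: "N > 0"
    by (simp add: N_def)
  define q where "q = shift_weight N (\<lambda>v. 1 / 2)"
  have q: "q i j = of_bool (j = 2 * (i mod N) \<or> j = 2 * (i mod N) + 1) / 2" for i j
    by (auto simp: q_def shift_weight_def)
  have modN: "2 * (i mod N) = 2 * i mod n" "2 * (i mod N) + 1 < n" for i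
    using mod_less_divisor[OF N, of i] unfolding n_def by (simp only: mult_mod_right, linarith)
  have mod_n: "i mod N = (if i < N then i else i - N)" if "i < n" for i
    using that by (simp add: n_def mod_if[of i] mod_if[of "i - N"])
  have q_sum: "(\<Sum>j<n. q i j * x j) = (x (2 * (i mod N)) + x (2 * (i mod N) + 1)) / 2" for i x
  proof -
    have "(\<Sum>j<n. q i j * x j) = (\<Sum>j\<in>{2 * (i mod N), 2 * (i mod N) + 1}. x j / 2)"
      using modN(2)[of i] by (intro sum.mono_neutral_cong_right) (auto simp: q)
    then show ?thesis
      by (simp add: add_divide_distrib)
  qed
  have q_col: "(\<Sum>i<n. q i j) = 1" if "j < n" for j
  proof -
    have "(\<Sum>i<n. q i j) = (\<Sum>i\<in>{j div 2, j div 2 + N}. 1 / 2)"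
    proof (rule sum.mono_neutral_cong_right)
      show "{j div 2, j div 2 + N} \<subseteq> {..<n}"
        using that by (auto simp: n_def)
      show "\<forall>i\<in>{..<n} - {j div 2, j div 2 + N}. q i j = 0"
        using that by (auto simp: q mod_n)
      show "q i j = 1 / 2" if "i \<in> {j div 2, j div 2 + N}" for i
        using that \<open>j < n\<close> by (auto simp: n_def q mod_n)
    qed simp
    then show ?thesis
      using N by simp
  qed
  define r where "r i j = q i j - (if i = 0 then 1 else 0)" for i j
  have r_sum: "(\<Sum>j<n. r i j * x j) = (\<Sum>j<n. q i j * x j) - (if i = 0 then \<Sum>j<n. x j else 0)" for i x
    by (simp add: r_def left_diff_distrib sum_subtractf)
  define K where "K = mat n n (\<lambda>(i, j). (if i = j then 1 else 0) - r i j)"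
  have "det K = 1"
    unfolding K_def
  proof (rule det_one_minus_eq_1)
    fix x l i
    assume l: "l \<noteq> 0" and eig: "\<And>i. i < n \<Longrightarrow> (\<Sum>j<n. r i j * x j) = l * x i" and i: "i < n"
    \<comment> \<open>The columns of \<open>r\<close> sum to 0, so the entries of an eigenvector for
      \<open>l \<noteq> 0\<close> sum to 0; on such vectors \<open>r\<close> and \<open>q\<close>
      act alike.\<close>
    have "l * (\<Sum>i<n. x i) = (\<Sum>i<n. \<Sum>j<n. r i j * x j)"
      unfolding sum_distrib_left using eig by (intro sum.cong) auto
    also have "\<dots> = (\<Sum>j<n. (\<Sum>i<n. q i j) * x j) - (\<Sum>j<n. x j)"
      unfolding r_sum sum_subtractf sum_distrib_right
      using N by (subst sum.swap) (simp add: n_def)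
    also have "\<dots> = 0"
      using q_col by simp
    finally have sum0: "(\<Sum>i<n. x i) = 0"
      using l by simp
    have step: "2 * l * x i = x (2 * i mod n) + x (2 * i mod n + 1)" if "i < n" for i
      using eig[OF that] unfolding r_sum sum0 q_sum modN(1) by (simp add: field_simps)
    \<comment> \<open>After \<open>t\<close> steps the walk from \<open>i\<close> is spread evenly
      over \<open>2 ^ t\<close> cyclically consecutive states; for \<open>t = Suc d\<close> these
      are all states once.\<close>
    have pow: "(2 * l) ^ t * x i = (\<Sum>c<2 ^ t. x ((2 ^ t * i + c) mod n))" if "i < n" for t i
    proof (induction t)
      case 0
      then show ?case
        using that by simp
    next
      case (Suc t)
      have "(2 * l) ^ Suc t * x i = (\<Sum>c<2 ^ t. 2 * l * x ((2 ^ t * i + c) mod n))"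
        using Suc by (simp add: sum_distrib_left mult.assoc)
      also have "\<dots> = (\<Sum>c<2 ^ t. x ((2 ^ Suc t * i + 2 * c) mod n) + x ((2 ^ Suc t * i + (2 * c + 1)) mod n))"
      proof (rule sum.cong)
        fix c
        let ?y = "2 ^ t * i + c"
        have "2 * (?y mod n) mod n = (2 ^ Suc t * i + 2 * c) mod n"
          by (simp add: mod_mult_right_eq algebra_simps)
        moreover have "2 * (?y mod n) mod n + 1 = (2 ^ Suc t * i + (2 * c + 1)) mod n"
        proof -
          have "2 * (?y mod n) mod n + 1 = (2 * (?y mod n) mod n + 1) mod n"
            using modN[of "?y mod n"] by simp
          then show ?thesis
            by (simp add: mod_simps algebra_simps)
        qed
        ultimately show "2 * l * x (?y mod n)
            = x ((2 ^ Suc t * i + 2 * c) mod n) + x ((2 ^ Suc t * i + (2 * c + 1)) mod n)"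
          using step[of "?y mod n"] N by (simp add: n_def)
      qed simp
      also have "\<dots> = (\<Sum>c<2 ^ Suc t. x ((2 ^ Suc t * i + c) mod n))"
        by (simp only: power_Suc sum_lessThan_double)
      finally show ?case .
    qed
    have n: "n = 2 ^ Suc d"
      by (simp add: n_def N_def)
    have "(2 * l) ^ Suc d * x i = (\<Sum>c<n. x c)"
      unfolding pow[OF i] n[symmetric] by (intro sum.cong) auto
    then show "x i = 0"
      using sum0 l by simp
  qed
  \<comment> \<open>Right multiplication by \<open>U\<close> adds all columns into column 0. Rows of
    \<open>q\<close> sum to 1, so only the entry \<open>n\<close> in row 0 survives there; it comes
    from the 1s subtracted in that row.\<close>
  define U where "U = mat n n (\<lambda>(i, j). if i = j \<or> j = 0 then 1 else 0 :: complex)"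
  have "det U = prod_list (diag_mat U)"
    by (rule det_lower_triangular[of n]) (auto simp: U_def)
  also have "diag_mat U = map (\<lambda>_. 1) [0..<n]"
    by (auto simp: diag_mat_def U_def)
  finally have detU: "det U = 1"
    by (simp add: map_replicate_const)
  have KU: "(K * U) $$ (i, j) = (if j = 0 then (if i = 0 then of_nat n else 0) else K $$ (i, j))"
    if "i < n" "j < n" for i j
  proof -
    have "(K * U) $$ (i, j) = (\<Sum>k<n. K $$ (i, k) * U $$ (k, j))"
      using that by (simp add: K_def U_def scalar_prod_def lessThan_atLeast0)
    also have "\<dots> = (\<Sum>k<n. K $$ (i, k) * (if k = j \<or> j = 0 then 1 else 0))"
      using that by (intro sum.cong) (auto simp: U_def)
    also have "\<dots> = (if j = 0 then (\<Sum>k<n. K $$ (i, k)) else K $$ (i, j))"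
      using that by (auto simp: if_distrib[of "\<lambda>y. _ * y"] cong: if_cong)
    also have "(\<Sum>k<n. K $$ (i, k)) = (if i = 0 then of_nat n else 0)"
      using that r_sum[of i "\<lambda>_. 1"] q_sum[of i "\<lambda>_. 1"] by (simp add: K_def sum_subtractf)
    finally show ?thesis .
  qed
  have KU_carrier: "K * U \<in> carrier_mat n n"
    by (rule mult_carrier_mat[of _ n n]) (simp_all add: K_def U_def)
  define M where "M = rooted_laplacian N (\<lambda>v. 1 / 2)"
  have M_carrier: "M \<in> carrier_mat n n"
    by (simp add: M_def rooted_laplacian_def n_def)
  have del: "mat_delete B 0 0 $$ (i, j) = B $$ (Suc i, Suc j)"
    if "B \<in> carrier_mat n n" "Suc i < n" "Suc j < n" for B :: "complex mat" and i j
    using that by (auto simp: mat_delete_def)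
  \<comment> \<open>\<open>K * U\<close> and \<open>M\<close> differ only in row 0 and column
    0.\<close>
  have "mat_delete (K * U) 0 0 = mat_delete M 0 0"
  proof (rule eq_matI)
    fix i j assume "i < dim_row (mat_delete M 0 0)" "j < dim_col (mat_delete M 0 0)"
    then have "Suc i < n" "Suc j < n"
      using M_carrier by auto
    then show "mat_delete (K * U) 0 0 $$ (i, j) = mat_delete M 0 0 $$ (i, j)"
      unfolding del[OF M_carrier \<open>Suc i < n\<close> \<open>Suc j < n\<close>] del[OF KU_carrier \<open>Suc i < n\<close> \<open>Suc j < n\<close>]
        KU[OF \<open>Suc i < n\<close> \<open>Suc j < n\<close>]
      by (simp add: K_def r_def M_def rooted_laplacian_def n_def q_def)
  qed (use M_carrier KU_carrier in auto)
  then have cof: "cofactor (K * U) 0 0 = cofactor M 0 0"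
    by (simp add: cofactor_def)
  have n0: "0 < n"
    using N by (simp add: n_def)
  have "1 = det (K * U)"
    using \<open>det K = 1\<close> detU by (subst det_mult[of _ n]) (auto simp: K_def U_def)
  also have "\<dots> = (\<Sum>i<n. (K * U) $$ (i, 0) * cofactor (K * U) i 0)"
    by (rule laplace_expansion_column[OF KU_carrier n0])
  also have "\<dots> = (\<Sum>i<n. if i = 0 then of_nat n * cofactor M 0 0 else 0)"
    using KU n0 cof by (intro sum.cong) auto
  also have "\<dots> = of_nat n * cofactor M 0 0"
    using n0 by simp
  also have "cofactor M 0 0 = (\<Sum>j<n. M $$ (0, j) * cofactor M 0 j)"
  proof -
    have "(\<Sum>j<n. M $$ (0, j) * cofactor M 0 j) = (\<Sum>j<n. if j = 0 then cofactor M 0 0 else 0)"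
      using n0 by (intro sum.cong) (auto simp: M_def rooted_laplacian_def n_def)
    then show ?thesis
      using n0 by simp
  qed
  also have "\<dots> = det M"
    by (rule laplace_expansion_row[OF M_carrier n0, symmetric])
  finally show ?thesis
    by (simp add: M_def n_def)
qed

text \<open>Summing the determinants over all \<open>T\<close> counts the single cycles, as each
  contributes 1 and any other permutation 0; the averaging lemma evaluates the sum.\<close>

lemma card_shift_step_reaching_0:
  fixes d :: nat
  defines "N \<equiv> 2 ^ d"
  shows "card {T. T \<subseteq> {..<N} \<and> (\<forall>v<2 * N. \<exists>k. (shift_step N T ^^ k) v = 0)} * (2 * N) = 2 ^ N"
proof -
  define G where "G = {T. T \<subseteq> {..<N} \<and> (\<forall>v<2 * N. \<exists>k. (shift_step N T ^^ k) v = 0)}"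
  \<comment> \<open>Weights are read only at residues below \<open>N\<close>, so the default
    \<open>1 / 2\<close> never occurs.\<close>
  have "rooted_laplacian N (\<lambda>v. if v \<in> T then 1 else if v \<in> {..<N} then 0 else 1 / 2)
      = rooted_laplacian N (\<lambda>v. of_bool (v \<in> T))" if "T \<subseteq> {..<N}" for T
    unfolding rooted_laplacian_def
    by (intro eq_matI) (auto simp: N_def shift_weight_def)
  then have "(\<Sum>T\<in>Pow {..<N}. det (rooted_laplacian N
        (\<lambda>v. if v \<in> T then 1 else if v \<in> {..<N} then 0 else 1 / 2)))
      = (\<Sum>T\<in>Pow {..<N}. of_bool (\<forall>v<2 * N. \<exists>k. (shift_step N T ^^ k) v = 0))"
    by (intro sum.cong) (auto simp: det_rooted_laplacian_shift_step N_def)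
  also have "\<dots> = of_nat (card G)"
    by (simp add: of_bool_def sum.If_cases G_def Int_def)
  finally have "of_nat (card G) = 2 ^ N * det (rooted_laplacian N (\<lambda>v. 1 / 2))"
    using sum_det_rooted_laplacian[of "{..<N}" N] by simp
  then have "of_nat (card G * (2 * N)) = (2 ^ N * (of_nat (2 * N) * det (rooted_laplacian N (\<lambda>v. 1 / 2))) :: complex)"
    by simp
  also have "\<dots> = of_nat (2 ^ N)"
    unfolding N_def det_rooted_laplacian_half by simp
  finally show ?thesis
    unfolding of_nat_eq_iff G_def .
qed

subsection \<open>Free actions of cyclic 2-groups\<close>

lemma funpow_orbit_absorb:
  assumes "(f ^^ n) x = x" "0 < n"
  shows "range (\<lambda>i. (f ^^ i) ((f ^^ k) x)) = range (\<lambda>i. (f ^^ i) x)"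
proof (intro equalityI subsetI)
  fix y assume "y \<in> range (\<lambda>i. (f ^^ i) x)"
  then obtain i where y: "y = (f ^^ i) x"
    by blast
  \<comment> \<open>Running through \<open>k\<close> extra periods leaves room to take off
    \<open>k\<close> steps without a negative exponent.\<close>
  have "(f ^^ (i + k * n)) x = (f ^^ i) x"
    using funpow_mod_eq[OF assms(1), of "i + k * n"] funpow_mod_eq[OF assms(1), of i] by simp
  moreover have "i + k * n = (i + k * (n - 1)) + k"
    using assms(2) by (cases n) auto
  ultimately have "y = (f ^^ (i + k * (n - 1))) ((f ^^ k) x)"
    unfolding y by (metis comp_apply funpow_add)
  then show "y \<in> range (\<lambda>i. (f ^^ i) ((f ^^ k) x))"
    by blast
qed (auto simp: funpow_add[symmetric, THEN fun_cong, unfolded comp_apply])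

text \<open>A coincidence gives a period \<open>r\<close> with \<open>0 < r < 2 ^ Suc e\<close>.
  Write \<open>r = 2 ^ a * q\<close> with \<open>q\<close> odd, so \<open>a \<le> e\<close>. Then
  \<open>r * 2 ^ (e - a)\<close> is a period congruent to \<open>2 ^ e\<close> modulo
  \<open>2 ^ Suc e\<close>, which contradicts \<open>half\<close>.\<close>

lemma inj_on_funpow_two_power:
  assumes period: "(f ^^ (2 ^ Suc e)) x = x" and half: "(f ^^ (2 ^ e)) x \<noteq> x"
  shows "inj_on (\<lambda>k. (f ^^ k) x) {..<2 ^ Suc e}"
proof (rule linorder_inj_onI')
  fix i j :: nat
  assume "i \<in> {..<2 ^ Suc e}" and j: "j \<in> {..<2 ^ Suc e}" and "i < j"
  show "(f ^^ i) x \<noteq> (f ^^ j) x"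
  proof
    assume eq: "(f ^^ i) x = (f ^^ j) x"
    define r where "r = j - i"
    have r: "0 < r" "r < 2 ^ Suc e"
      using \<open>i < j\<close> j by (auto simp: r_def)
    \<comment> \<open>Applying \<open>2 ^ Suc e - i\<close> further steps to the coincidence turns
      its left side into \<open>x\<close> and its right side into the iterate number
      \<open>r\<close>.\<close>
    have "(f ^^ r) x = (f ^^ ((r + 2 ^ Suc e) mod 2 ^ Suc e)) x"
      using r by simp
    also have "r + 2 ^ Suc e = (2 ^ Suc e - i) + j"
      using \<open>i \<in> _\<close> \<open>i < j\<close> by (simp add: r_def)
    also have "(f ^^ (\<dots> mod 2 ^ Suc e)) x = (f ^^ \<dots>) x"
      by (rule funpow_mod_eq[OF period])
    also have "\<dots> = (f ^^ ((2 ^ Suc e - i) + i)) x"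
      unfolding funpow_add comp_apply eq ..
    also have "\<dots> = x"
      using period \<open>i \<in> _\<close> by simp
    finally have fr: "(f ^^ r) x = x" .
    obtain q where q: "r = 2 ^ multiplicity 2 r * q" "odd q"
      using multiplicity_decompose'[of r 2] r by auto
    define a where "a = multiplicity 2 r"
    have "a \<le> e"
    proof (rule ccontr)
      assume "\<not> a \<le> e"
      then have "2 ^ Suc e dvd (2 :: nat) ^ a"
        by (intro le_imp_power_dvd) simp
      then have "2 ^ Suc e dvd r"
        using q(1) unfolding a_def[symmetric] by (metis dvd_mult2)
      then show False
        using r by (meson dvd_imp_le not_le)
    qed
    then have "r * 2 ^ (e - a) = 2 ^ e * q"
      using q(1) unfolding a_def[symmetric] by (simp add: mult.commute mult.left_commute flip: power_add)
    moreover obtain s where "q = 2 * s + 1"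
      using \<open>odd q\<close> by (elim oddE)
    ultimately have "(r * 2 ^ (e - a)) mod 2 ^ Suc e = 2 ^ e"
      by (simp add: algebra_simps mod_add_eq[symmetric])
    moreover have "(f ^^ (r * 2 ^ (e - a))) x = x"
      using funpow_mod_eq[OF fr, of "r * 2 ^ (e - a)"] by simp
    ultimately show False
      using funpow_mod_eq[OF period, of "r * 2 ^ (e - a)"] half by simp
  qed
qed

text \<open>The orbits partition \<open>A\<close>, and each has full size because the only
  involution of the cyclic group fixes no point.\<close>

lemma card_orbits_two_power:
  assumes A: "finite A" "\<And>x. x \<in> A \<Longrightarrow> f x \<in> A"
    and period: "\<And>x. x \<in> A \<Longrightarrow> (f ^^ (2 ^ Suc e)) x = x"
    and half: "\<And>x. x \<in> A \<Longrightarrow> (f ^^ (2 ^ e)) x \<noteq> x"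
  shows "card ((\<lambda>x. range (\<lambda>k. (f ^^ k) x)) ` A) * 2 ^ Suc e = card A"
proof -
  define orb where "orb x = range (\<lambda>k. (f ^^ k) x)" for x
  have closed: "orb x \<subseteq> A" if "x \<in> A" for x
  proof -
    have "(f ^^ k) x \<in> A" for k
      by (induction k) (use that A(2) in auto)
    then show ?thesis
      by (auto simp: orb_def)
  qed
  have self: "x \<in> orb x" for x
    unfolding orb_def by (rule range_eqI[of _ _ 0]) simp
  have orb_eq: "orb y = orb x" if "x \<in> A" "y \<in> orb x" for x y
    using that funpow_orbit_absorb[OF period[OF that(1)]] by (auto simp: orb_def)
  have card_orb: "card (orb x) = 2 ^ Suc e" if "x \<in> A" for x
  proof -
    have "orb x = (\<lambda>k. (f ^^ k) x) ` {..<2 ^ Suc e}"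
      unfolding orb_def
    proof (intro equalityI image_subsetI)
      fix k
      show "(f ^^ k) x \<in> (\<lambda>k. (f ^^ k) x) ` {..<2 ^ Suc e}"
        using funpow_mod_eq[OF period[OF that], of k]
        by (intro image_eqI[of _ _ "k mod 2 ^ Suc e"]) auto
    qed auto
    then show ?thesis
      using card_image[OF inj_on_funpow_two_power[OF period[OF that] half[OF that]]] by simp
  qed
  have union: "\<Union> (orb ` A) = A"
    using closed self by blast
  have "2 ^ Suc e * card (orb ` A) = card (\<Union> (orb ` A))"
  proof (rule card_partition)
    show "finite (\<Union> (orb ` A))"
      unfolding union by (rule A(1))
    show "c1 \<inter> c2 = {}" if "c1 \<in> orb ` A" "c2 \<in> orb ` A" "c1 \<noteq> c2" for c1 c2
      using that orb_eq by blast
  qed (use A(1) card_orb in auto)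
  then show ?thesis
    unfolding union orb_def by (simp add: mult.commute)
qed

section \<open>Necklaces with an odd number of ones\<close>

lemma necklace_eq_range: "necklace w = range (\<lambda>k. (rotate1 ^^ k) w)"
  by (auto simp: necklace_def rotate_def)

lemma count_list_rotate1: "count_list (rotate1 w) x = count_list w x"
  by (cases w) auto

text \<open>The last \<open>n\<close> letters are free, and the first one is forced by
  parity.\<close>

lemma card_odd_words: "card {w :: bool list. length w = Suc n \<and> odd (count_list w True)} = 2 ^ n"
proof -
  have "{w :: bool list. length w = Suc n \<and> odd (count_list w True)}
      = (\<lambda>u. even (count_list u True) # u) ` {u. length u = n}"
    by (auto simp: length_Suc_conv image_iff split: if_splits)
  moreover have "card {u :: bool list. length u = n} = 2 ^ n"
    using card_lists_length_eq[of "UNIV :: bool set" n] by simp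
  ultimately show ?thesis
    by (simp add: card_image inj_on_def)
qed

text \<open>A word fixed by rotation through half its length is a square \<open>u @ u\<close> and
  has an even number of ones, so rotation acts freely here.\<close>

lemma card_odd_necklaces: "card (odd_necklaces (2 ^ Suc e)) * 2 ^ Suc e = 2 ^ (2 ^ Suc e - 1)"
proof -
  define A where "A = {w :: bool list. length w = 2 ^ Suc e \<and> odd (count_list w True)}"
  have "card ((\<lambda>w. range (\<lambda>k. (rotate1 ^^ k) w)) ` A) * 2 ^ Suc e = card A"
  proof (rule card_orbits_two_power)
    show "finite A"
      using finite_lists_length_eq[of "UNIV :: bool set" "2 ^ Suc e"]
      by (rule finite_subset[rotated]) (auto simp: A_def)
    show "rotate1 w \<in> A" if "w \<in> A" for w
      using that by (simp add: A_def count_list_rotate1)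
    show "(rotate1 ^^ 2 ^ Suc e) w = w" if "w \<in> A" for w
      using that rotate_id[of "2 ^ Suc e" w] by (simp add: A_def rotate_def)
    show "(rotate1 ^^ 2 ^ e) w \<noteq> w" if "w \<in> A" for w
    proof
      assume "(rotate1 ^^ 2 ^ e) w = w"
      then have eq: "drop (2 ^ e) w @ take (2 ^ e) w = take (2 ^ e) w @ drop (2 ^ e) w"
        using that rotate_drop_take[of "2 ^ e" w] by (simp add: A_def rotate_def)
      have "drop (2 ^ e) w = take (2 ^ e) w"
        by (rule conjunct1[OF iffD1[OF append_eq_append_conv eq]]) (use that in \<open>simp add: A_def\<close>)
      then have "count_list w True = 2 * count_list (take (2 ^ e) w) True"
        by (metis append_take_drop_id count_list_append mult_2)
      then show False
        using that by (simp add: A_def)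
    qed
  qed
  then show ?thesis
    using card_odd_words[of "2 ^ Suc e - 1"]
    by (simp add: odd_necklaces_def A_def necklace_eq_range[abs_def])
qed

subsection \<open>De Bruijn words as cyclic shifts\<close>

text \<open>The \<open>m\<close> lowest binary digits, most significant first. The recursion splits
  off the last letter because a shift step appends there.\<close>

fun bits :: "nat \<Rightarrow> nat \<Rightarrow> bool list" where
  "bits 0 v = []"
| "bits (Suc m) v = bits m (v div 2) @ [odd v]"

lemma length_bits [simp]: "length (bits m v) = m"
  by (induction m arbitrary: v) auto

lemma bits_Suc_Cons: "bits (Suc m) v = odd (v div 2 ^ m) # bits m v"
  by (induction m arbitrary: v) (simp_all add: div_mult2_eq)

lemma bits_mod: "bits m (v mod 2 ^ m) = bits m v"
proof (induction m arbitrary: v)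
  case (Suc m)
  have "v mod 2 ^ Suc m div 2 = (v div 2) mod 2 ^ m"
    by (simp only: power_Suc mod_mult2_eq)
  then show ?case
    using Suc[of "v div 2"] dvd_mod_iff[of 2 "2 ^ Suc m" v] by simp
qed simp

lemma bits_0: "bits m 0 = replicate m False"
  by (induction m) (simp_all add: replicate_append_same)

lemma inj_on_bits: "inj_on (bits m) {..<2 ^ m}"
proof (induction m)
  case (Suc m)
  show ?case
  proof (rule inj_onI)
    fix u v assume uv: "u \<in> {..<2 ^ Suc m}" "v \<in> {..<2 ^ Suc m}" "bits (Suc m) u = bits (Suc m) v"
    then have "u div 2 = v div 2"
      using inj_onD[OF Suc, of "u div 2" "v div 2"] by auto
    moreover have "odd u = odd v"
      using uv(3) by simp
    ultimately show "u = v"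
      by (metis bit_eq_rec)
  qed
qed (simp add: inj_on_def)

lemma bits_surj:
  assumes "length u = m"
  obtains v where "v < 2 ^ m" "bits m v = u"
proof -
  have "bits m ` {..<2 ^ m} = {u. length u = m}"
  proof (rule card_subset_eq)
    show "finite {u :: bool list. length u = m}"
      using finite_lists_length_eq[of "UNIV :: bool set" m] by simp
    show "card (bits m ` {..<2 ^ m}) = card {u :: bool list. length u = m}"
      using card_lists_length_eq[of "UNIV :: bool set" m] by (simp add: card_image[OF inj_on_bits])
  qed auto
  then show ?thesis
    using assms that by (metis (mono_tags, lifting) imageE lessThan_iff mem_Collect_eq)
qed

section \<open>Cyclic factors and normalized de Bruijn words\<close>

lemma cyclic_factor_Suc: "cyclic_factor w i (Suc m) = cyclic_factor w i m @ [w ! ((i + m) mod length w)]"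
  by (simp add: cyclic_factor_def)

lemma cyclic_factor_Suc_Cons:
  "cyclic_factor w i (Suc m) = w ! (i mod length w) # cyclic_factor w (Suc i) m"
  unfolding cyclic_factor_def by (subst upt_conv_Cons) (simp_all add: map_Suc_upt[symmetric] o_def del: upt_Suc)

lemma length_cyclic_factor [simp]: "length (cyclic_factor w i m) = m"
  by (simp add: cyclic_factor_def)

lemma cyclic_factor_mod: "cyclic_factor w (i mod length w) m = cyclic_factor w i m"
  by (simp add: cyclic_factor_def mod_simps)

lemma cyclic_factor_rotate: "w \<noteq> [] \<Longrightarrow> cyclic_factor (rotate k w) i m = cyclic_factor w (k + i) m"
  by (simp add: cyclic_factor_def nth_rotate mod_simps add.assoc)

text \<open>There are as many positions as words of length \<open>m\<close>, so occurrence of every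
  word forces uniqueness. Positions need no bound, since factors are periodic in them.\<close>

lemma is_de_bruijn_iff:
  "is_de_bruijn m w \<longleftrightarrow> length w = 2 ^ m \<and> (\<forall>u. length u = m \<longrightarrow> (\<exists>i. cyclic_factor w i m = u))"
proof
  assume "length w = 2 ^ m \<and> (\<forall>u. length u = m \<longrightarrow> (\<exists>i. cyclic_factor w i m = u))"
  then have len: "length w = 2 ^ m" and ex: "\<And>u. length u = m \<Longrightarrow> \<exists>i. cyclic_factor w i m = u"
    by auto
  have ex': "\<exists>i. i < length w \<and> cyclic_factor w i m = u" if u: "length u = m" for u
  proof -
    obtain i where "cyclic_factor w i m = u"
      using ex[OF u] by blast
    then show ?thesis
      using len cyclic_factor_mod[of w i m] by (intro exI[of _ "i mod length w"]) simp
  qed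
  have "inj_on (\<lambda>i. cyclic_factor w i m) {..<length w}"
  proof (rule eq_card_imp_inj_on)
    have "(\<lambda>i. cyclic_factor w i m) ` {..<length w} = {u. length u = m}"
    proof (intro equalityI subsetI)
      fix u :: "bool list" assume "u \<in> {u. length u = m}"
      then obtain i where "i < length w" "cyclic_factor w i m = u"
        using ex' by blast
      then show "u \<in> (\<lambda>i. cyclic_factor w i m) ` {..<length w}"
        by (intro image_eqI[of _ _ i]) auto
    qed auto
    then show "card ((\<lambda>i. cyclic_factor w i m) ` {..<length w}) = card {..<length w}"
      using card_lists_length_eq[of "UNIV :: bool set" m] by (simp add: len)
  qed simp
  then show "is_de_bruijn m w"
    unfolding is_de_bruijn_def using len ex' by (auto simp: inj_on_def)
qed (auto simp: is_de_bruijn_def)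

lemma is_de_bruijn_rotate:
  assumes "is_de_bruijn m w"
  shows "is_de_bruijn m (rotate k w)"
  unfolding is_de_bruijn_iff
proof (intro conjI allI impI)
  show "length (rotate k w) = 2 ^ m"
    using assms by (simp add: is_de_bruijn_def)
  fix u :: "bool list" assume "length u = m"
  then obtain i where i: "cyclic_factor w i m = u"
    using assms by (auto simp: is_de_bruijn_iff)
  have w: "w \<noteq> []"
    using assms by (auto simp: is_de_bruijn_def)
  \<comment> \<open>Modulo the length, adding \<open>k * (length w - 1)\<close> amounts to
    subtracting \<open>k\<close>.\<close>
  have "k + (i + k * (length w - 1)) = i + k * length w"
    using w by (cases "length w") auto
  then have "(k + (i + k * (length w - 1))) mod length w = i mod length w"
    by (metis mod_mult_self1)
  then show "\<exists>i. cyclic_factor (rotate k w) i m = u"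
    unfolding cyclic_factor_rotate[OF w] using i cyclic_factor_mod by metis
qed

text \<open>The zero word occurs exactly once, so exactly one rotation in each necklace starts with
  it.\<close>

lemma card_de_bruijn_words_normalized:
  "card (de_bruijn_words m)
    = card {w. is_de_bruijn m w \<and> cyclic_factor w 0 m = replicate m False}"
    (is "_ = card ?D")
proof -
  have "inj_on necklace ?D"
  proof (rule inj_onI)
    fix w w' assume w: "w \<in> ?D" and w': "w' \<in> ?D" and eq: "necklace w = necklace w'"
    have "w' \<in> necklace w"
      unfolding eq by (auto simp: necklace_def intro: exI[of _ 0])
    then obtain k where k: "w' = rotate k w"
      by (auto simp: necklace_def)
    have len: "length w = 2 ^ m"
      using w by (simp add: is_de_bruijn_def)
    then have "w \<noteq> []"
      by auto
    then have "cyclic_factor w (k mod length w) m = replicate m False"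
      using w' cyclic_factor_rotate[of w k 0 m] by (simp add: k cyclic_factor_mod)
    moreover have "k mod length w < length w" "0 < length w"
      using len by simp_all
    ultimately have "k mod length w = 0"
      using w unfolding is_de_bruijn_def by (auto dest!: spec[of _ "replicate m False"])
    then show "w = w'"
      using k rotate_id by metis
  qed
  moreover have "necklace ` ?D = de_bruijn_words m"
  proof (intro equalityI subsetI)
    fix c assume "c \<in> de_bruijn_words m"
    then obtain w where w: "is_de_bruijn m w" "c = necklace w"
      by (auto simp: de_bruijn_words_def)
    then have len: "length w = 2 ^ m" "w \<noteq> []"
      by (auto simp: is_de_bruijn_def)
    obtain i where "cyclic_factor w i m = replicate m False"
      using w by (metis is_de_bruijn_iff length_replicate)
    then have "rotate i w \<in> ?D"
      using is_de_bruijn_rotate[OF w(1), of i] cyclic_factor_rotate[OF len(2), of i 0 m] by simp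
    moreover have "necklace (rotate i w) = necklace w"
      using funpow_orbit_absorb[where f = rotate1 and n = "length w" and x = w and k = i] len(2) rotate_id[of "length w" w]
      by (simp add: necklace_eq_range rotate_def)
    ultimately show "c \<in> necklace ` ?D"
      using w(2) by (metis (no_types, lifting) image_eqI)
  qed (auto simp: de_bruijn_words_def)
  ultimately show ?thesis
    using card_image[of necklace ?D] by simp
qed

text \<open>By finiteness \<open>f\<close> permutes the orbit of \<open>x0\<close>, and by
  injectivity the orbit cannot be entered from outside. Whatever reaches \<open>x0\<close> therefore
  lies on the orbit already.\<close>

lemma orbit_eq_if_reaches:
  assumes S: "finite S" "\<And>x. x \<in> S \<Longrightarrow> f x \<in> S" "inj_on f S" "x0 \<in> S"
    and reach: "\<And>x. x \<in> S \<Longrightarrow> \<exists>k. (f ^^ k) x = x0"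
  shows "range (\<lambda>i. (f ^^ i) x0) = S" and "(f ^^ card S) x0 = x0"
proof -
  define a where "a i = (f ^^ i) x0" for i
  have aS: "a i \<in> S" for i
    by (induction i) (use S in \<open>auto simp: a_def\<close>)
  have fS: "f ` range a = range a"
  proof (rule card_subset_eq)
    show "finite (range a)"
      using aS S(1) by (meson finite_subset image_subsetI)
    show "f ` range a \<subseteq> range a"
      by (auto simp: a_def intro: range_eqI[of _ _ "Suc _"])
    show "card (f ` range a) = card (range a)"
      using aS by (intro card_image inj_on_subset[OF S(3)]) auto
  qed
  have "x \<in> range a" if "(f ^^ k) x = x0" "x \<in> S" for k x
    using that
  proof (induction k arbitrary: x)
    case 0
    then show ?case
      by (auto simp: a_def intro: range_eqI[of _ _ 0])
  next
    case (Suc k)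
    then have "f x \<in> f ` range a"
      using S(2) fS by (simp add: funpow_swap1)
    then show ?case
      using inj_onD[OF S(3)] aS Suc.prems(2) by blast
  qed
  then have range: "range a = S"
    using reach aS by blast
  then show "range (\<lambda>i. (f ^^ i) x0) = S"
    by (simp add: a_def[abs_def])
  obtain k where "(f ^^ k) (f x0) = x0"
    using reach S by blast
  then have ex: "\<exists>p>0. a p = x0"
    by (auto simp: a_def funpow_swap1 intro: exI[of _ "Suc k"])
  \<comment> \<open>The first \<open>p\<close> iterates, for the least period \<open>p\<close>, are
    distinct and exhaust \<open>S\<close>; hence \<open>p = card S\<close>.\<close>
  define p where "p = (LEAST p. 0 < p \<and> a p = x0)"
  have p: "0 < p" "a p = x0"
    using LeastI_ex[OF ex] by (auto simp: p_def)
  have a_mod: "a (i mod p) = a i" for i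
    using funpow_mod_eq[of p f x0 i] p(2) by (simp add: a_def)
  have "inj_on a {..<p}"
  proof (rule linorder_inj_onI')
    fix i j assume "i \<in> {..<p}" "j \<in> {..<p}" "i < j"
    \<comment> \<open>If \<open>a i = a j\<close>, then \<open>p - i\<close> further steps lead back
      to \<open>x0\<close>, making \<open>j - i\<close> a period below \<open>p\<close>.\<close>
    then have "0 < j + (p - i) - p" "j + (p - i) - p < p" "(j + (p - i)) mod p = j + (p - i) - p"
      by (auto simp: le_mod_geq)
    then have "a (j + (p - i)) \<noteq> x0"
      using not_less_Least[of "j + (p - i) - p" "\<lambda>p. 0 < p \<and> a p = x0"] a_mod[of "j + (p - i)"]
      by (auto simp: p_def[symmetric])
    moreover have "a (i + (p - i)) = x0"
      using p \<open>i \<in> _\<close> by simp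
    ultimately show "a i \<noteq> a j"
      unfolding a_def by (metis add.commute comp_apply funpow_add)
  qed
  moreover have "a ` {..<p} = S"
    unfolding range[symmetric]
  proof (intro equalityI image_subsetI)
    show "a i \<in> a ` {..<p}" for i
      using a_mod[of i] p(1) by (metis image_eqI lessThan_iff mod_less_divisor)
  qed auto
  ultimately have "card S = p"
    using card_image by fastforce
  then show "(f ^^ card S) x0 = x0"
    using p(2) by (simp add: a_def)
qed

text \<open>Halving the image recovers the residue modulo \<open>N\<close>, and its parity then
  tells which half the state came from.\<close>

lemma inj_on_shift_step: "inj_on (shift_step N T) {..<2 * N}"
proof (rule inj_onI)
  fix u v assume uv: "u \<in> {..<2 * N}" "v \<in> {..<2 * N}" "shift_step N T u = shift_step N T v"
  have "u mod N = v mod N"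
    using arg_cong[OF uv(3), of "\<lambda>x. x div 2"] by (simp add: shift_step_def)
  moreover have "N \<le> u \<longleftrightarrow> N \<le> v"
    using arg_cong[OF uv(3), of even] calculation
    by (auto simp: shift_step_def of_bool_def split: if_splits)
  moreover have "x = (if N \<le> x then x mod N + N else x mod N)" if "x \<in> {..<2 * N}" for x
    using that by (auto simp: le_mod_geq)
  ultimately show "u = v"
    using uv(1,2) by metis
qed

lemma bits_shift_step:
  "bits (Suc d) (shift_step (2 ^ d) T v) = bits d v @ [(v mod 2 ^ d \<in> T) \<noteq> (2 ^ d \<le> v)]"
  by (simp add: shift_step_def bits_mod)

lemma bits_Suc_Cons_le: "v < 2 ^ Suc d \<Longrightarrow> bits (Suc d) v = (2 ^ d \<le> v) # bits d v"
proof -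
  assume "v < 2 ^ Suc d"
  then have "v div 2 ^ d = (if 2 ^ d \<le> v then 1 else 0)"
    by (auto simp: div_nat_eqI)
  then show ?thesis
    by (simp only: bits_Suc_Cons) simp
qed

text \<open>Each step moves the digits one place to the front, so digit \<open>j\<close> of
  \<open>a i\<close> is the leading digit of \<open>a (i + j)\<close>, which is the letter of
  \<open>w\<close> there.\<close>

lemma cyclic_factor_eq_bits:
  assumes a: "\<And>i. a (Suc i) = shift_step (2 ^ d) T (a i)" "\<And>i. a i < 2 ^ Suc d"
    and w: "\<And>i. w ! (i mod length w) = (2 ^ d \<le> a i)"
  shows "cyclic_factor w i (Suc d) = bits (Suc d) (a i)"
proof (rule nth_equalityI)
  fix j assume "j < length (cyclic_factor w i (Suc d))"
  then have "j < Suc d"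
    by (simp add: cyclic_factor_def)
  moreover have "bits (Suc d) (a i) ! j = (2 ^ d \<le> a (i + j))" if "j < Suc d" for j
    using that
  proof (induction j arbitrary: i)
    case 0
    then show ?case
      using bits_Suc_Cons_le[OF a(2)] by simp
  next
    case (Suc j)
    have "bits (Suc d) (a i) ! Suc j = bits d (a i) ! j"
      using bits_Suc_Cons_le[OF a(2)] by simp
    also have "\<dots> = bits (Suc d) (a (Suc i)) ! j"
      unfolding a(1) bits_shift_step using Suc.prems by (simp add: nth_append)
    finally show ?case
      using Suc by simp
  qed
  ultimately show "cyclic_factor w i (Suc d) ! j = bits (Suc d) (a i) ! j"
    using w by (simp add: cyclic_factor_def del: upt_Suc)
qed (simp add: cyclic_factor_def)

text \<open>A single cycle, followed from 0, spells a de Bruijn word by its leading digits.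
  Conversely, the successive factors of a de Bruijn word form such a cycle, from which
  \<open>T\<close> can be read off.\<close>

lemma card_normalized_de_bruijn:
  fixes d :: nat
  defines "N \<equiv> 2 ^ d"
  shows "card {w. is_de_bruijn (Suc d) w \<and> cyclic_factor w 0 (Suc d) = replicate (Suc d) False}
    = card {T. T \<subseteq> {..<N} \<and> (\<forall>v<2 * N. \<exists>k. (shift_step N T ^^ k) v = 0)}"
    (is "card ?D = card ?G")
proof -
  define n where "n = 2 * N"
  have n: "n = 2 ^ Suc d" "0 < n"
    by (simp_all add: n_def N_def)
  define a where "a T i = (shift_step N T ^^ i) 0" for T i
  define word where "word T = map (\<lambda>i. N \<le> a T i) [0..<n]" for T
  have a_Suc: "a T (Suc i) = shift_step N T (a T i)" for T i
    by (simp add: a_def)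
  have a_less: "a T i < n" for T i
    by (induction i) (use n in \<open>auto simp: a_Suc n_def shift_step_less\<close>, simp add: a_def)
  have orbit: "range (a T) = {..<n}" "a T (i mod n) = a T i" if "T \<in> ?G" for T i
  proof -
    have *: "\<exists>k. (shift_step N T ^^ k) x = 0" if "x \<in> {..<n}" for x
      using \<open>T \<in> ?G\<close> that by (simp add: n_def)
    have "range (\<lambda>i. (shift_step N T ^^ i) 0) = {..<n}" "(shift_step N T ^^ card {..<n}) 0 = 0"
      by (rule orbit_eq_if_reaches; use * n(2) inj_on_shift_step in \<open>auto simp: n_def shift_step_less\<close>)+
    then show "range (a T) = {..<n}" "a T (i mod n) = a T i"
      using funpow_mod_eq[of n "shift_step N T" 0 i] by (simp_all add: a_def[abs_def])
  qed
  have factor: "cyclic_factor (word T) i (Suc d) = bits (Suc d) (a T i)" if "T \<in> ?G" for T i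
  proof (rule cyclic_factor_eq_bits)
    show "word T ! (j mod length (word T)) = (2 ^ d \<le> a T j)" for j
      using n(2) orbit(2)[OF that, of j] by (simp add: word_def N_def)
  qed (use a_Suc a_less in \<open>auto simp: N_def n(1)\<close>)
  have a_eq: "a T i = a T' i" if "T \<in> ?G" "T' \<in> ?G" "word T = word T'" for T T' i
    using that factor[of T i] factor[of T' i] a_less n(1) inj_onD[OF inj_on_bits, of "Suc d" "a T i" "a T' i"]
    by (metis lessThan_iff)
  have "inj_on word ?G"
  proof (rule inj_onI)
    fix T T' assume T: "T \<in> ?G" "T' \<in> ?G" "word T = word T'"
    \<comment> \<open>Every \<open>v < N\<close> lies on the cycle, and the parity of the state
      after it reveals whether \<open>v \<in> T\<close>.\<close>
    have "v \<in> T \<longleftrightarrow> v \<in> T'" if "v < N" for v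
    proof -
      have "v \<in> range (a T)"
        unfolding orbit(1)[OF T(1)] using that by (simp add: n_def)
      then obtain i where i: "a T i = v"
        by auto
      then have "shift_step N T v = shift_step N T' v"
        using a_eq[OF T, of i] a_eq[OF T, of "Suc i"] by (simp add: a_Suc)
      then show ?thesis
        using that by (simp add: shift_step_def of_bool_eq_iff)
    qed
    then show "T = T'"
      using T by blast
  qed
  moreover have "word ` ?G = ?D"
  proof (intro equalityI subsetI)
    fix w assume "w \<in> word ` ?G"
    then obtain T where T: "T \<in> ?G" "w = word T"
      by blast
    have "\<exists>i. cyclic_factor w i (Suc d) = u" if u: "length u = Suc d" for u
    proof -
      obtain v where "v < n" "bits (Suc d) v = u"
        using bits_surj[OF u] n(1) by metis
      moreover from this obtain i where "a T i = v"
        using orbit(1)[OF T(1)] by (metis imageE lessThan_iff)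
      ultimately show ?thesis
        using factor[OF T(1)] T(2) by metis
    qed
    moreover have "cyclic_factor w 0 (Suc d) = replicate (Suc d) False"
      unfolding T(2) factor[OF T(1)] by (simp only: a_def funpow_0 bits_0)
    ultimately show "w \<in> ?D"
      using n(1) T(2) by (simp add: is_de_bruijn_iff word_def)
  next
    fix w assume w: "w \<in> ?D"
    then have len: "length w = n"
      using n(1) by (simp add: is_de_bruijn_def)
    have "\<exists>v. v < n \<and> bits (Suc d) v = cyclic_factor w i (Suc d)" for i
      using bits_surj[of "cyclic_factor w i (Suc d)" "Suc d"] n(1) by (metis length_cyclic_factor)
    \<comment> \<open>\<open>s i\<close> is the state whose digits form the factor at position
      \<open>i\<close>.\<close>
    then obtain s where s: "\<And>i. s i < n" "\<And>i. bits (Suc d) (s i) = cyclic_factor w i (Suc d)"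
      by metis
    have s_eq: "s i = v" if "v < n" "bits (Suc d) v = cyclic_factor w i (Suc d)" for i v
      by (rule inj_onD[OF inj_on_bits, of "Suc d"])
        (use that s in \<open>simp_all only: n(1)[symmetric] lessThan_iff\<close>)
    have s_mod: "s (i mod n) = s i" for i
      using s_eq[OF s(1)] s(2) cyclic_factor_mod[of w i] len by metis
    have s_inj: "i mod n = j mod n" if "s i = s j" for i j
    proof -
      have "cyclic_factor w (i mod n) (Suc d) = cyclic_factor w (j mod n) (Suc d)"
        using that s(2) cyclic_factor_mod len by metis
      moreover have "length (cyclic_factor w (j mod n) (Suc d)) = Suc d"
        by (simp add: cyclic_factor_def)
      moreover have "i mod n < length w" "j mod n < length w"
        using n(2) len by simp_all
      ultimately show ?thesis
        using w unfolding is_de_bruijn_def by blast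
    qed
    have s_surj: "\<exists>i. s i = v" if "v < n" for v
    proof -
      obtain i where "cyclic_factor w i (Suc d) = bits (Suc d) v"
        using w is_de_bruijn_iff[of "Suc d" w] length_bits[of "Suc d" v] by blast
      then show ?thesis
        using s_eq[OF that, of i] by metis
    qed
    have s0: "s 0 = 0"
      using w n(2) by (intro s_eq) (auto simp del: bits.simps simp: bits_0)
    have w_nth: "w ! (i mod n) = (N \<le> s i)" and tail: "cyclic_factor w (Suc i) d = bits d (s i)" for i
      using s(2)[of i] bits_Suc_Cons_le[of "s i" d] s(1)[of i] n(1)
      by (simp_all add: cyclic_factor_Suc_Cons len N_def del: bits.simps)
    \<comment> \<open>Consecutive factors overlap in \<open>d\<close> letters, so only the last
      digit of the next state is open.\<close>
    have s_next: "s (Suc i) = 2 * (s i mod N) + of_bool (odd (s (Suc i)))" for i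
    proof (rule s_eq)
      have "s i mod N < N"
        by (simp add: N_def)
      then show "2 * (s i mod N) + of_bool (odd (s (Suc i))) < n"
        by (simp add: n_def of_bool_def)
      have "bits (Suc d) (s (Suc i)) = bits d (s i) @ [w ! ((Suc i + d) mod length w)]"
        unfolding s(2) cyclic_factor_Suc tail ..
      then show "bits (Suc d) (2 * (s i mod N) + of_bool (odd (s (Suc i)))) = cyclic_factor w (Suc i) (Suc d)"
        unfolding s(2)[symmetric] by (simp add: N_def bits_mod)
    qed
    \<comment> \<open>The choice of \<open>i\<close> does not matter: a factor occurs at one
      position modulo \<open>n\<close> only, so \<open>s i\<close> determines the next
      state.\<close>
    define T where "T = {v. v < N \<and> (\<exists>i. s i = v \<and> odd (s (Suc i)))}"
    have s_cong: "s (Suc i) = s (Suc j)" if "s i = s j" for i j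
      using s_inj[OF that] s_mod by (metis mod_Suc_eq)
    have s_step: "s (Suc i) = shift_step N T (s i)" for i
    proof -
      have inT: "s j \<in> T \<longleftrightarrow> odd (s (Suc j))" if "s j < N" for j
        unfolding T_def mem_Collect_eq using that s_cong by metis
      have "odd (s (Suc i)) \<longleftrightarrow> (s i mod N \<in> T) \<noteq> (N \<le> s i)"
      proof (cases "s i < N")
        case True
        then show ?thesis
          using inT by simp
      next
        case False
        then have mod: "s i mod N = s i - N" "s i - N < N"
          using s(1)[of i] by (simp_all add: n_def le_mod_geq)
        then obtain j where j: "s j = s i - N"
          using s_surj[of "s i - N"] by (auto simp: n_def)
        \<comment> \<open>The two states share their last \<open>d\<close> letters. With the same
          next letter they would have the same successor, and one factor would occur at two
          positions.\<close>
        have "odd (s (Suc j)) \<noteq> odd (s (Suc i))"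
        proof
          assume "odd (s (Suc j)) = odd (s (Suc i))"
          then have "s (Suc j) = s (Suc i)"
            using s_next[of i] s_next[of j] mod j by simp
          then have "Suc j mod n = Suc i mod n"
            by (rule s_inj)
          then have "(Suc j + (n - 1)) mod n = (Suc i + (n - 1)) mod n"
            by (rule mod_add_cong) simp
          then have "j mod n = i mod n"
            using n(2) by simp
          then have "s j = s i"
            using s_mod by metis
          then show False
            using j mod(2) False by linarith
        qed
        then show ?thesis
          using inT[of j] j mod False by simp
      qed
      then show ?thesis
        using s_next[of i] by (simp add: shift_step_def)
    qed
    have s_funpow: "(shift_step N T ^^ i) (s j) = s (i + j)" for i j
      by (induction i) (simp_all add: s_step)
    have a_s: "a T i = s i" for i
      using s_funpow[of i 0] by (simp add: a_def s0)
    have "\<exists>k. (shift_step N T ^^ k) v = 0" if v: "v < 2 * N" for v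
    proof -
      obtain i where i: "s i = v"
        using s_surj v by (auto simp: n_def)
      \<comment> \<open>The number of steps is chosen so that, counted from position 0, the total is
        a multiple of \<open>n\<close>.\<close>
      have "(shift_step N T ^^ (n * i + n - i)) v = s (n * i + n)"
        using n(2) by (simp add: i[symmetric] s_funpow trans_le_add1)
      also have "\<dots> = 0"
        using s_mod[of "n * i + n"] s0 by simp
      finally show ?thesis
        by blast
    qed
    then have "T \<in> ?G"
      by (auto simp: T_def)
    moreover have "word T = w"
    proof (rule nth_equalityI)
      fix i assume "i < length (word T)"
      then show "word T ! i = w ! i"
        using w_nth[of i] by (simp add: word_def a_s)
    qed (simp add: word_def len)
    ultimately show "w \<in> word ` ?G"
      by blast
  qed
  ultimately show ?thesis
    using card_image[of word ?G] by simp
qed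

lemma card_de_bruijn_words:
  "card (de_bruijn_words (Suc d)) * (2 * 2 ^ d) = 2 ^ (2 ^ d)"
  unfolding card_de_bruijn_words_normalized card_normalized_de_bruijn
  by (rule card_shift_step_reaching_0)

subsection \<open>Normal bases\<close>

definition frob :: "('a, 'b) ring_scheme \<Rightarrow> 'a \<Rightarrow> 'a" where
  "frob R x = x \<otimes>\<^bsub>R\<^esub> x"

text \<open>In characteristic 2 this is the operator \<open>1 + \<phi>\<close>.\<close>

definition artin_schreier :: "('a, 'b) ring_scheme \<Rightarrow> 'a \<Rightarrow> 'a" where
  "artin_schreier R x = x \<oplus>\<^bsub>R\<^esub> frob R x"

text \<open>Stated for a monoid so that it applies to the additive monoid of the field, once for
  each of the two operators above.\<close>

lemma (in monoid) funpow_additive: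
  assumes closed: "\<And>x. x \<in> carrier G \<Longrightarrow> f x \<in> carrier G"
    and hom: "\<And>x y. \<lbrakk>x \<in> carrier G; y \<in> carrier G\<rbrakk> \<Longrightarrow> f (x \<otimes> y) = f x \<otimes> f y"
  shows "x \<in> carrier G \<Longrightarrow> (f ^^ k) x \<in> carrier G"
    and "\<lbrakk>x \<in> carrier G; y \<in> carrier G\<rbrakk> \<Longrightarrow> (f ^^ k) (x \<otimes> y) = (f ^^ k) x \<otimes> (f ^^ k) y"
proof -
  show *: "(f ^^ k) x \<in> carrier G" if "x \<in> carrier G" for k x
    using that by (induction k) (auto simp: closed)
  show "(f ^^ k) (x \<otimes> y) = (f ^^ k) x \<otimes> (f ^^ k) y" if "x \<in> carrier G" "y \<in> carrier G"
    using that * by (induction k) (auto simp: hom)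
qed

text \<open>The order of the additive group annihilates \<open>\<one>\<close>. As
  \<open>2 ^ k\<close> times \<open>\<one>\<close> is a power of
  \<open>\<one> \<oplus> \<one>\<close>, the absence of zero divisors gives the claim.\<close>

lemma (in field) char_two_if_order:
  assumes "order R = 2 ^ k"
  shows "\<one> \<oplus> \<one> = \<zero>"
proof -
  have two_pow: "[(2 ^ j :: nat)] \<cdot> \<one> = \<zero> \<Longrightarrow> \<one> \<oplus> \<one> = \<zero>" for j
  proof (induction j)
    case (Suc j)
    have two: "[(2 :: nat)] \<cdot> \<one> = \<one> \<oplus> \<one>"
      by (simp add: numeral_2_eq_2)
    have "([(2 ^ j :: nat)] \<cdot> \<one>) \<otimes> (\<one> \<oplus> \<one>) = [(2 ^ j :: nat)] \<cdot> (\<one> \<oplus> \<one>)"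
      using add_pow_ldistr[of \<one> "\<one> \<oplus> \<one>" "2 ^ j"] by simp
    also have "\<dots> = [(2 ^ Suc j :: nat)] \<cdot> \<one>"
      unfolding two[symmetric] by (simp add: add.nat_pow_pow)
    finally show ?case
      using Suc integral[of "[(2 ^ j :: nat)] \<cdot> \<one>" "\<one> \<oplus> \<one>"] by auto
  qed simp
  have "[order R] \<cdot> \<one> = \<zero>"
    using add.pow_order_eq_1[of \<one>] by (simp add: Coset.order_def)
  then show ?thesis
    using two_pow[of k] assms by simp
qed

context field
begin

lemma frob_closed [simp]: "x \<in> carrier R \<Longrightarrow> frob R x \<in> carrier R"
  by (simp add: frob_def)

lemma artin_schreier_closed [simp]: "x \<in> carrier R \<Longrightarrow> artin_schreier R x \<in> carrier R"
  by (simp add: artin_schreier_def)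

lemma funpow_frob: "x \<in> carrier R \<Longrightarrow> (frob R ^^ i) x = x [^] ((2 :: nat) ^ i)"
proof (induction i)
  case (Suc i)
  have "x [^] ((2 :: nat) ^ Suc i) = (x [^] ((2 :: nat) ^ i)) [^] (2 :: nat)"
    using Suc.prems by (simp add: nat_pow_pow mult.commute)
  then show ?case
    using Suc by (simp add: frob_def numeral_2_eq_2)
qed simp

lemma frobenius_orbit_eq: "x \<in> carrier R \<Longrightarrow> frobenius_orbit R n x = map (\<lambda>i. (frob R ^^ i) x) [0..<n]"
  by (simp add: frobenius_orbit_def funpow_frob)

lemma funpow_frob_period:
  assumes "order R = 2 ^ n" "x \<in> carrier R"
  shows "(frob R ^^ n) x = x"
proof (cases "x = \<zero>")
  case False
  have fin: "finite (carrier R)"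
    using assms(1) by (intro card_ge_0_finite) (simp add: Coset.order_def)
  interpret M: group "Multiplicative_Group.mult_of R"
    by (rule field_mult_group)
  have "x [^] ((2 :: nat) ^ n - 1) = \<one>"
    using M.pow_order_eq_1[of x] False assms order_mult_of[OF fin] by (simp add: Multiplicative_Group.nat_pow_mult_of)
  then have "x [^] Suc ((2 :: nat) ^ n - 1) = x"
    using assms(2) by (simp only: nat_pow_Suc l_one)
  moreover have "Suc ((2 :: nat) ^ n - 1) = 2 ^ n"
    by simp
  ultimately show ?thesis
    using funpow_frob[OF assms(2)] by metis
qed (simp add: funpow_frob nat_pow_zero)

section \<open>Frobenius and Artin-Schreier operators in characteristic 2\<close>

context
  assumes char2: "\<one> \<oplus> \<one> = \<zero>"
begin

lemma add_self: "x \<in> carrier R \<Longrightarrow> x \<oplus> x = \<zero>"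
  using char2 r_distr[of \<one> \<one> x] by (metis l_null l_one one_closed l_distr)

lemma add_add_self: "\<lbrakk>x \<in> carrier R; y \<in> carrier R\<rbrakk> \<Longrightarrow> x \<oplus> (x \<oplus> y) = y"
  by (simp add: add_self a_assoc[symmetric])

lemma add_eq_zero_iff: "\<lbrakk>x \<in> carrier R; y \<in> carrier R\<rbrakk> \<Longrightarrow> x \<oplus> y = \<zero> \<longleftrightarrow> x = y"
  by (metis add_self add_add_self r_zero)

lemma frob_add: "\<lbrakk>x \<in> carrier R; y \<in> carrier R\<rbrakk> \<Longrightarrow> frob R (x \<oplus> y) = frob R x \<oplus> frob R y"
  by (simp add: frob_def l_distr r_distr a_ac m_comm add_add_self)

lemma artin_schreier_add:
  "\<lbrakk>x \<in> carrier R; y \<in> carrier R\<rbrakk> \<Longrightarrow> artin_schreier R (x \<oplus> y) = artin_schreier R x \<oplus> artin_schreier R y"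
  by (simp add: artin_schreier_def frob_add a_ac)

lemma funpow_frob_closed [simp]: "x \<in> carrier R \<Longrightarrow> (frob R ^^ k) x \<in> carrier R"
  using add.funpow_additive(1)[of "frob R" x k] by (simp add: frob_add)

lemma funpow_frob_add:
  "\<lbrakk>x \<in> carrier R; y \<in> carrier R\<rbrakk> \<Longrightarrow> (frob R ^^ k) (x \<oplus> y) = (frob R ^^ k) x \<oplus> (frob R ^^ k) y"
  using add.funpow_additive(2)[of "frob R" x y k] by (simp add: frob_add)

lemma funpow_artin_schreier_closed [simp]: "x \<in> carrier R \<Longrightarrow> (artin_schreier R ^^ k) x \<in> carrier R"
  using add.funpow_additive(1)[of "artin_schreier R" x k] by (simp add: artin_schreier_add)

lemma funpow_artin_schreier_add:
  "\<lbrakk>x \<in> carrier R; y \<in> carrier R\<rbrakk> \<Longrightarrow>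
    (artin_schreier R ^^ k) (x \<oplus> y) = (artin_schreier R ^^ k) x \<oplus> (artin_schreier R ^^ k) y"
  using add.funpow_additive(2)[of "artin_schreier R" x y k] by (simp add: artin_schreier_add)

lemma frob_artin_schreier: "x \<in> carrier R \<Longrightarrow> frob R (artin_schreier R x) = artin_schreier R (frob R x)"
  by (simp add: artin_schreier_def frob_add)

lemma funpow_artin_schreier_frob:
  "x \<in> carrier R \<Longrightarrow> (artin_schreier R ^^ k) (frob R x) = frob R ((artin_schreier R ^^ k) x)"
  by (induction k) (simp_all add: frob_artin_schreier)

text \<open>This is \<open>(1 + \<phi>) ^ (2 ^ j) = 1 + \<phi> ^ (2 ^ j)\<close>: on each doubling
  the two mixed terms cancel.\<close>

lemma funpow_artin_schreier_two_power:
  "x \<in> carrier R \<Longrightarrow> (artin_schreier R ^^ (2 ^ j)) x = x \<oplus> (frob R ^^ (2 ^ j)) x"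
proof (induction j arbitrary: x)
  case 0
  then show ?case
    by (simp add: artin_schreier_def)
next
  case (Suc j)
  have dbl: "(f ^^ (2 ^ Suc j)) y = (f ^^ (2 ^ j)) ((f ^^ (2 ^ j)) y)" for f :: "'a \<Rightarrow> 'a" and y
    by (simp add: mult_2 funpow_add)
  show ?case
    unfolding dbl using Suc by (simp add: funpow_frob_add a_assoc add_add_self)
qed

lemma artin_schreier_eq_zero_iff:
  "x \<in> carrier R \<Longrightarrow> artin_schreier R x = \<zero> \<longleftrightarrow> x = \<zero> \<or> x = \<one>"
proof -
  assume x: "x \<in> carrier R"
  have "artin_schreier R x = x \<otimes> (\<one> \<oplus> x)"
    using x by (simp add: artin_schreier_def frob_def r_distr)
  then show ?thesis
    using x integral_iff[of x "\<one> \<oplus> x"] add_eq_zero_iff[of \<one> x] by auto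
qed

text \<open>A fibre of the operator contains at most \<open>z\<close> and
  \<open>z \<oplus> \<one>\<close>, so one more iteration at most doubles the kernel.\<close>

lemma card_ker_funpow_artin_schreier:
  assumes "finite (carrier R)"
  shows "card {x \<in> carrier R. (artin_schreier R ^^ k) x = \<zero>} \<le> 2 ^ k"
proof (induction k)
  case 0
  have "{x \<in> carrier R. (artin_schreier R ^^ 0) x = \<zero>} = {\<zero>}"
    by auto
  then show ?case
    by simp
next
  case (Suc k)
  define K where "K = {x \<in> carrier R. (artin_schreier R ^^ k) x = \<zero>}"
  have K: "finite K"
    using assms by (simp add: K_def)
  have fibre: "card {x \<in> carrier R. artin_schreier R x = y} \<le> 2" for y
  proof (cases "{x \<in> carrier R. artin_schreier R x = y} = {}")
    case True
    then show ?thesis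
      by (simp only: card.empty le0)
  next
    case False
    then obtain z where z: "z \<in> carrier R" "artin_schreier R z = y"
      by blast
    have "x \<in> set [z, z \<oplus> \<one>]" if "x \<in> carrier R" "artin_schreier R x = y" for x
    proof -
      have "artin_schreier R (z \<oplus> x) = \<zero>"
        using that z by (auto simp: artin_schreier_add add_self)
      then have "z \<oplus> x = \<zero> \<or> z \<oplus> x = \<one>"
        using that z by (simp add: artin_schreier_eq_zero_iff)
      then show ?thesis
        using that z add_add_self[of z x] by auto
    qed
    then have "{x \<in> carrier R. artin_schreier R x = y} \<subseteq> set [z, z \<oplus> \<one>]"
      by blast
    then have "card {x \<in> carrier R. artin_schreier R x = y} \<le> card (set [z, z \<oplus> \<one>])"
      by (rule card_mono[rotated]) simp
    also have "\<dots> \<le> 2"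
      using card_length[of "[z, z \<oplus> \<one>]"] by simp
    finally show ?thesis .
  qed
  have "{x \<in> carrier R. (artin_schreier R ^^ Suc k) x = \<zero>}
      \<subseteq> (\<Union>y\<in>K. {x \<in> carrier R. artin_schreier R x = y})"
    by (auto simp: K_def funpow_swap1)
  then have "card {x \<in> carrier R. (artin_schreier R ^^ Suc k) x = \<zero>}
      \<le> card (\<Union>y\<in>K. {x \<in> carrier R. artin_schreier R x = y})"
    by (rule card_mono[rotated]) (use assms K in auto)
  also have "\<dots> \<le> (\<Sum>y\<in>K. card {x \<in> carrier R. artin_schreier R x = y})"
    by (rule card_UN_le[OF K])
  also have "\<dots> \<le> (\<Sum>y\<in>K. 2)"
    using fibre by (rule sum_mono)
  also have "\<dots> \<le> 2 ^ Suc k"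
    using Suc by (simp add: K_def)
  finally show ?case .
qed

lemma subfield_prime: "subfield {\<zero>, \<one>} R"
proof (rule subfieldI')
  show "subring {\<zero>, \<one>} R"
    by (rule subringI) (use char2 in \<open>auto simp: minus_equality\<close>)
qed auto

lemma subgroup_ker_funpow_artin_schreier:
  "subgroup {x \<in> carrier R. (artin_schreier R ^^ k) x = \<zero>} (add_monoid R)"
proof (rule add.subgroupI)
  have "(artin_schreier R ^^ k) \<zero> = \<zero>"
    by (induction k) (simp_all add: artin_schreier_def frob_def)
  then show "{x \<in> carrier R. (artin_schreier R ^^ k) x = \<zero>} \<noteq> {}"
    by blast
  fix x assume "x \<in> {x \<in> carrier R. (artin_schreier R ^^ k) x = \<zero>}"
  then show "\<ominus> x \<in> {x \<in> carrier R. (artin_schreier R ^^ k) x = \<zero>}"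
    using add_self[of x] by (simp add: minus_equality)
qed (auto simp: funpow_artin_schreier_add)

text \<open>There are as many coefficient lists as field elements, so if taking combinations is
  onto, it is also injective.\<close>

lemma independent_if_Span_eq_carrier:
  assumes order: "order R = 2 ^ length Us" and Us: "set Us \<subseteq> carrier R"
    and span: "Span {\<zero>, \<one>} Us = carrier R"
  shows "independent {\<zero>, \<one>} Us"
proof (rule trivial_combine_imp_independent[OF subfield_prime Us])
  fix Ks assume Ks: "set Ks \<subseteq> {\<zero>, \<one>}" "combine Ks Us = \<zero>"
  define L where "L = {Ls. set Ls \<subseteq> {\<zero>, \<one>} \<and> length Ls = length Us}"
  have "(\<lambda>Ls. combine Ls Us) ` L = carrier R"
    using Span_eq_combine_set_length_version[OF subfield_prime Us] span by (auto simp: L_def)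
  moreover have "card L = 2 ^ length Us" "finite L"
    using card_lists_length_eq[of "{\<zero>, \<one>}" "length Us"] finite_lists_length_eq[of "{\<zero>, \<one>}" "length Us"]
    by (simp_all add: L_def numeral_2_eq_2)
  ultimately have inj: "inj_on (\<lambda>Ls. combine Ls Us) L"
    using order by (intro eq_card_imp_inj_on) (simp_all add: Coset.order_def)
  \<comment> \<open>\<open>combine\<close> ignores surplus coefficients and treats missing ones as
    zero; \<open>Ks\<close> is cut and padded to the length of \<open>Us\<close>.\<close>
  define Ks' where "Ks' = take (length Us) Ks"
  have Ks': "set Ks' \<subseteq> {\<zero>, \<one>}" "length Ks' \<le> length Us"
    using Ks(1) set_take_subset[of "length Us" Ks] by (auto simp: Ks'_def)
  define Ls where "Ls = Ks' @ replicate (length Us - length Ks') \<zero>"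
  have "combine Ls Us = combine (replicate (length Us) \<zero>) Us"
    using Ks(2) combine_append_replicate[OF Us] combine_take[of Us Ks] combine_replicate[OF Us]
    by (simp add: Ls_def Ks'_def)
  moreover have "Ls \<in> L" "replicate (length Us) \<zero> \<in> L"
    using Ks' by (auto simp: Ls_def L_def)
  ultimately have "Ls = replicate (length Us) \<zero>"
    using inj_onD[OF inj] by blast
  then have "set Ls \<subseteq> {\<zero>}"
    by auto
  then show "set (take (length Us) Ks) \<subseteq> {\<zero>}"
    by (simp add: Ls_def Ks'_def)
qed

section \<open>Generators of normal bases\<close>

context
  fixes e :: nat
  assumes order: "order R = 2 ^ (2 ^ Suc e)"
begin

lemma finite_carrier: "finite (carrier R)"
  using order by (intro card_ge_0_finite) (simp add: Coset.order_def)

lemma funpow_artin_schreier_full: "x \<in> carrier R \<Longrightarrow> (artin_schreier R ^^ (2 ^ Suc e)) x = \<zero>"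
  using funpow_artin_schreier_two_power[of x "Suc e"] funpow_frob_period[OF order] add_self by simp

lemma funpow_artin_schreier_top:
  assumes "x \<in> carrier R"
  shows "(artin_schreier R ^^ (2 ^ Suc e - 1)) x \<in> {\<zero>, \<one>}"
proof -
  have "(2 :: nat) ^ Suc e = Suc (2 ^ Suc e - 1)"
    by simp
  then have "artin_schreier R ((artin_schreier R ^^ (2 ^ Suc e - 1)) x) = \<zero>"
    using funpow_artin_schreier_full[OF assms] by (metis comp_apply funpow.simps(2))
  then show ?thesis
    using assms by (simp add: artin_schreier_eq_zero_iff)
qed

text \<open>The kernel of this iterate has at most half as many elements as the field.\<close>

lemma ex_artin_schreier_top_nonzero:
  "\<exists>x\<in>carrier R. (artin_schreier R ^^ (2 ^ Suc e - 1)) x \<noteq> \<zero>"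
proof (rule ccontr)
  assume "\<not> ?thesis"
  then have "{x \<in> carrier R. (artin_schreier R ^^ (2 ^ Suc e - 1)) x = \<zero>} = carrier R"
    by auto
  then have "(2 :: nat) ^ (2 ^ Suc e) \<le> 2 ^ (2 ^ Suc e - 1)"
    using card_ker_funpow_artin_schreier[OF finite_carrier, of "2 ^ Suc e - 1"] order
    by (simp only: Coset.order_def)
  moreover have "(2 :: nat) ^ (2 ^ Suc e - 1) < 2 ^ (2 ^ Suc e)"
    by (rule power_strict_increasing) simp_all
  ultimately show False
    by (metis not_le)
qed

text \<open>The span is closed under the Artin-Schreier map, and by induction on \<open>i\<close> it contains the
  kernel of the \<open>i\<close>-th iterate: a vector sent to \<open>\<one>\<close> by that iterate differs from a suitable
  iterate of \<open>g\<close> by an element of the kernel.\<close>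

lemma Span_frobenius_orbit_eq_carrier:
  assumes g: "g \<in> carrier R" and top: "(artin_schreier R ^^ (2 ^ Suc e - 1)) g \<noteq> \<zero>"
  shows "Span {\<zero>, \<one>} (frobenius_orbit R (2 ^ Suc e) g) = carrier R"
proof -
  define n :: nat where "n = 2 ^ Suc e"
  have n: "0 < n"
    by (simp add: n_def)
  define Us where "Us = frobenius_orbit R n g"
  have Us: "set Us = (\<lambda>i. (frob R ^^ i) g) ` {..<n}"
    by (auto simp: Us_def frobenius_orbit_eq[OF g])
  have Us_sub: "set Us \<subseteq> carrier R"
    using g by (auto simp: Us)
  define W where "W = Span {\<zero>, \<one>} Us"
  note W_props = Span_subgroup_props[OF subfield_prime Us_sub, folded W_def]
  have orbW: "(frob R ^^ i) g \<in> W" for i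
  proof -
    have "(frob R ^^ i) g = (frob R ^^ (i mod n)) g"
      using funpow_mod_eq[of n "frob R" g i] funpow_frob_period[OF order g] by (simp add: n_def)
    also have "\<dots> \<in> set Us"
      using n by (auto simp: Us)
    finally show ?thesis
      using Span_base_incl[OF subfield_prime Us_sub] by (auto simp: W_def)
  qed
  \<comment> \<open>Closure of \<open>W\<close> under Frobenius is \<open>W \<subseteq> E\<close>;
    by minimality of the span it is enough that \<open>E\<close> is an additive subgroup containing
    the conjugates of \<open>g\<close>.\<close>
  define E where "E = {x \<in> carrier R. frob R x \<in> W}"
  have "W \<subseteq> E"
    unfolding W_def
  proof (rule Span_min[OF subfield_prime Us_sub])
    show "subgroup E (add_monoid R)"
    proof (rule add.subgroupI)
      have "\<zero> \<in> E"
        using W_props by (simp add: E_def frob_def)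
      then show "E \<noteq> {}"
        by blast
      show "\<ominus> x \<in> E" if "x \<in> E" for x
        using that add_self[of x] by (simp add: minus_equality E_def)
    qed (use W_props in \<open>auto simp: E_def frob_add\<close>)
    show "{\<zero>, \<one>} <#> set Us \<subseteq> E"
    proof
      fix x assume "x \<in> {\<zero>, \<one>} <#> set Us"
      then obtain k u where "k \<in> {\<zero>, \<one>}" "u \<in> set Us" "x = k \<otimes> u"
        unfolding set_mult_def by blast
      then consider "x = \<zero>" | i where "x = (frob R ^^ i) g"
        using g by (auto simp: Us)
      then show "x \<in> E"
      proof cases
        case 1
        then show ?thesis
          using W_props by (simp add: E_def frob_def)
      next
        case (2 i)
        then show ?thesis
          using g orbW[of "Suc i"] by (simp add: E_def)
      qed
    qed
  qed
  then have stepW: "artin_schreier R x \<in> W" if "x \<in> W" for x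
    using that W_props by (auto simp: artin_schreier_def E_def)
  have hW: "(artin_schreier R ^^ i) g \<in> W" for i
    by (induction i) (use stepW orbW[of 0] in auto)
  have "x \<in> W" if "i \<le> n" "x \<in> carrier R" "(artin_schreier R ^^ i) x = \<zero>" for i x
    using that
  proof (induction i arbitrary: x)
    case 0
    then show ?case
      using W_props by simp
  next
    case (Suc i)
    have "artin_schreier R ((artin_schreier R ^^ i) x) = \<zero>"
      using Suc.prems(3) by simp
    then consider "(artin_schreier R ^^ i) x = \<zero>" | "(artin_schreier R ^^ i) x = \<one>"
      using Suc.prems(2) artin_schreier_eq_zero_iff by auto
    then show ?case
    proof cases
      case 1
      then show ?thesis
        using Suc by simp
    next
      case 2
      \<comment> \<open>The exponent is chosen so that \<open>i\<close> further iterations reach the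
        top iterate of \<open>g\<close>, which is \<open>\<one>\<close>.\<close>
      define y where "y = (artin_schreier R ^^ (n - 1 - i)) g"
      have "(artin_schreier R ^^ i) y = (artin_schreier R ^^ (i + (n - 1 - i))) g"
        by (simp add: y_def funpow_add)
      also have "i + (n - 1 - i) = n - 1"
        using Suc.prems(1) by simp
      also have "(artin_schreier R ^^ \<dots>) g = \<one>"
        using funpow_artin_schreier_top[OF g] top by (simp add: n_def)
      finally have "(artin_schreier R ^^ i) (y \<oplus> x) = \<zero>"
        using 2 g Suc.prems(2) by (simp add: funpow_artin_schreier_add y_def char2)
      then have "y \<oplus> x \<in> W"
        using Suc g by (simp add: y_def)
      then have "y \<oplus> (y \<oplus> x) \<in> W"
        using W_props(3) hW by (simp add: y_def)
      then show ?thesis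
        using g Suc.prems(2) by (simp add: y_def add_add_self)
    qed
  qed
  then have "carrier R \<subseteq> W"
    using funpow_artin_schreier_full by (auto simp: n_def)
  then show ?thesis
    using W_props(1) by (auto simp: W_def Us_def n_def)
qed

text \<open>The kernel of the top iterate is a proper subspace stable under Frobenius; if it
  contained \<open>g\<close>, it would contain the span of all conjugates.\<close>

lemma Span_frobenius_orbit_eq_carrierD:
  assumes g: "g \<in> carrier R"
    and span: "Span {\<zero>, \<one>} (frobenius_orbit R n g) = carrier R"
  shows "(artin_schreier R ^^ (2 ^ Suc e - 1)) g \<noteq> \<zero>"
proof
  assume top: "(artin_schreier R ^^ (2 ^ Suc e - 1)) g = \<zero>"
  define E where "E = {x \<in> carrier R. (artin_schreier R ^^ (2 ^ Suc e - 1)) x = \<zero>}"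
  have gE: "(frob R ^^ i) g \<in> E" for i
    by (induction i) (use g top in \<open>auto simp: E_def funpow_artin_schreier_frob\<close>, simp add: frob_def)
  have "Span {\<zero>, \<one>} (frobenius_orbit R n g) \<subseteq> E"
  proof (rule Span_min[OF subfield_prime])
    show "set (frobenius_orbit R n g) \<subseteq> carrier R"
      using g by (auto simp: frobenius_orbit_eq)
    show "subgroup E (add_monoid R)"
      unfolding E_def by (rule subgroup_ker_funpow_artin_schreier)
    then have "\<zero> \<in> E"
      using subgroup.one_closed by fastforce
    then show "{\<zero>, \<one>} <#> set (frobenius_orbit R n g) \<subseteq> E"
      using g gE by (auto simp: set_mult_def frobenius_orbit_eq)
  qed
  then show False
    using ex_artin_schreier_top_nonzero span by (auto simp: E_def)
qed

text \<open>The top iterate is additive with values in \<open>{\<zero>, \<one>}\<close>. Adding an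
  element \<open>g\<close> with value \<open>\<one>\<close> exchanges its kernel with the
  complement, so each is half of the field.\<close>

lemma card_artin_schreier_top_nonzero:
  "card {x \<in> carrier R. (artin_schreier R ^^ (2 ^ Suc e - 1)) x \<noteq> \<zero>} = 2 ^ (2 ^ Suc e - 1)"
proof -
  define t where "t = artin_schreier R ^^ (2 ^ Suc e - 1)"
  obtain g where g: "g \<in> carrier R" "t g \<noteq> \<zero>"
    using ex_artin_schreier_top_nonzero by (auto simp: t_def)
  have t1: "t x = \<one>" if "x \<in> carrier R" "t x \<noteq> \<zero>" for x
    using funpow_artin_schreier_top[OF that(1)] that(2) by (simp add: t_def)
  have t_add: "t (x \<oplus> y) = t x \<oplus> t y" if "x \<in> carrier R" "y \<in> carrier R" for x y
    using that by (simp add: t_def funpow_artin_schreier_add)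
  have tg: "t g = \<one>"
    using t1 g by blast
  have invol: "g \<oplus> (g \<oplus> x) = x" if "x \<in> carrier R" for x
    using g that by (simp add: add_add_self)
  have "bij_betw (\<lambda>x. g \<oplus> x) {x \<in> carrier R. t x \<noteq> \<zero>} {x \<in> carrier R. t x = \<zero>}"
    by (rule bij_betw_byWitness[where f' = "\<lambda>x. g \<oplus> x"])
      (use g char2 in \<open>auto simp: t_add tg t1 invol\<close>)
  then have "card {x \<in> carrier R. t x \<noteq> \<zero>} = card {x \<in> carrier R. t x = \<zero>}"
    by (rule bij_betw_same_card)
  moreover have "card (carrier R) = card {x \<in> carrier R. t x \<noteq> \<zero>} + card {x \<in> carrier R. t x = \<zero>}"
    using finite_carrier by (subst card_Un_disjoint[symmetric]) (auto intro: arg_cong[of _ _ card])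
  ultimately have "2 * card {x \<in> carrier R. t x \<noteq> \<zero>} = 2 ^ (Suc (2 ^ Suc e - 1))"
    using order by (simp add: Coset.order_def)
  then show ?thesis
    unfolding t_def power_Suc[of _ "2 ^ Suc e - 1"] by simp
qed

text \<open>By periodicity the listed conjugates form the full Frobenius orbit. Spanning implies
  independence by counting, and it holds exactly when the top iterate does not vanish.\<close>

lemma normal_bases_eq:
  "normal_bases R (2 ^ Suc e) = (\<lambda>x. range (\<lambda>k. (frob R ^^ k) x))
    ` {x \<in> carrier R. (artin_schreier R ^^ (2 ^ Suc e - 1)) x \<noteq> \<zero>}"
proof -
  have orbit: "set (frobenius_orbit R (2 ^ Suc e) g) = range (\<lambda>k. (frob R ^^ k) g)"
    if g: "g \<in> carrier R" for g
  proof -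
    have "(frob R ^^ k) g \<in> (\<lambda>k. (frob R ^^ k) g) ` {..<2 ^ Suc e}" for k
      using funpow_mod_eq[OF funpow_frob_period[OF order g], of k]
      by (intro image_eqI[of _ _ "k mod 2 ^ Suc e"]) auto
    then show ?thesis
      by (auto simp: frobenius_orbit_eq[OF g] atLeast0LessThan)
  qed
  have normal_iff: "independent {\<zero>, \<one>} (frobenius_orbit R (2 ^ Suc e) g) \<and>
      Span {\<zero>, \<one>} (frobenius_orbit R (2 ^ Suc e) g) = carrier R
      \<longleftrightarrow> (artin_schreier R ^^ (2 ^ Suc e - 1)) g \<noteq> \<zero>" if g: "g \<in> carrier R" for g
  proof -
    have "set (frobenius_orbit R (2 ^ Suc e) g) \<subseteq> carrier R"
      using g by (auto simp: frobenius_orbit_eq)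
    moreover have "length (frobenius_orbit R (2 ^ Suc e) g) = 2 ^ Suc e"
      by (simp add: frobenius_orbit_def)
    ultimately show ?thesis
      using Span_frobenius_orbit_eq_carrier[OF g] Span_frobenius_orbit_eq_carrierD[OF g]
        independent_if_Span_eq_carrier[of "frobenius_orbit R (2 ^ Suc e) g"] order by metis
  qed
  show ?thesis
    unfolding normal_bases_def setcompr_eq_image
  proof (rule image_cong)
    show "{g. g \<in> carrier R \<and> independent {\<zero>, \<one>} (frobenius_orbit R (2 ^ Suc e) g) \<and>
        Span {\<zero>, \<one>} (frobenius_orbit R (2 ^ Suc e) g) = carrier R}
      = {x \<in> carrier R. (artin_schreier R ^^ (2 ^ Suc e - 1)) x \<noteq> \<zero>}"
      using normal_iff by (intro Collect_cong conj_cong) (auto simp del: Span.simps)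
  qed (use orbit in auto)
qed

text \<open>A generator fixed by \<open>\<phi> ^ (2 ^ e)\<close> would be killed by
  \<open>(1 + \<phi>) ^ (2 ^ e)\<close>, hence by the top iterate, whose exponent is at least
  \<open>2 ^ e\<close>. So Frobenius acts freely on generators.\<close>

lemma card_normal_bases_mult: "card (normal_bases R (2 ^ Suc e)) * 2 ^ Suc e = 2 ^ (2 ^ Suc e - 1)"
proof -
  define A where "A = {x \<in> carrier R. (artin_schreier R ^^ (2 ^ Suc e - 1)) x \<noteq> \<zero>}"
  have "card ((\<lambda>x. range (\<lambda>k. (frob R ^^ k) x)) ` A) * 2 ^ Suc e = card A"
  proof (rule card_orbits_two_power)
    show "finite A"
      using finite_carrier by (simp add: A_def)
    show "frob R x \<in> A" if "x \<in> A" for x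
      using that integral[of "(artin_schreier R ^^ (2 ^ Suc e - 1)) x"]
      by (auto simp: A_def funpow_artin_schreier_frob frob_def[of R "(artin_schreier R ^^ _) x"])
    show "(frob R ^^ (2 ^ Suc e)) x = x" if "x \<in> A" for x
      using that funpow_frob_period[OF order] by (simp add: A_def)
    show "(frob R ^^ (2 ^ e)) x \<noteq> x" if "x \<in> A" for x
    proof
      assume "(frob R ^^ (2 ^ e)) x = x"
      then have "(artin_schreier R ^^ (2 ^ e)) x = \<zero>"
        using that by (simp add: A_def funpow_artin_schreier_two_power add_self)
      moreover have "(artin_schreier R ^^ k) \<zero> = \<zero>" for k
        by (induction k) (simp_all add: artin_schreier_def frob_def)
      moreover have "(2 :: nat) ^ Suc e - 1 = (2 ^ e - 1) + 2 ^ e"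
        by simp
      ultimately have "(artin_schreier R ^^ (2 ^ Suc e - 1)) x = \<zero>"
        by (simp only: funpow_add comp_apply)
      then show False
        using that by (simp add: A_def)
    qed
  qed
  then show ?thesis
    using card_artin_schreier_top_nonzero by (simp only: normal_bases_eq A_def)
qed

end

end

end

section \<open>Comparison of the three cardinalities\<close>

lemma card_normal_bases:
  assumes "field F" "order F = 2 ^ (2 ^ Suc e)"
  shows "card (normal_bases F (2 ^ Suc e)) * 2 ^ Suc e = 2 ^ (2 ^ Suc e - 1)"
  using field.card_normal_bases_mult[OF assms(1) field.char_two_if_order[OF assms] assms(2)] .

theorem theorem29:
  fixes d :: nat
  assumes "d \<ge> 1"
  shows "(\<exists>f. bij_betw f (de_bruijn_words (d + 1)) (odd_necklaces (2 ^ d))) \<and>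
    (\<forall>F :: ('a, 'b) ring_scheme. field F \<and> order F = 2 ^ (2 ^ d) \<longrightarrow>
       (\<exists>g. bij_betw g (odd_necklaces (2 ^ d)) (normal_bases F (2 ^ d))) \<and>
       (\<exists>h. bij_betw h (de_bruijn_words (d + 1)) (normal_bases F (2 ^ d))))"
proof -
  \<comment> \<open>A positive \<open>d\<close> provides the involution, iterate number
    \<open>2 ^ e\<close>, on which the free actions rest.\<close>
  obtain e where d: "d = Suc e"
    using assms by (cases d) auto
  have odd: "card (odd_necklaces (2 ^ d)) * 2 ^ d = 2 ^ (2 ^ d - 1)"
    unfolding d by (rule card_odd_necklaces)
  have "2 * (card (de_bruijn_words (d + 1)) * 2 ^ d) = 2 ^ Suc (2 ^ d - 1)"
    using card_de_bruijn_words[of d] by (simp add: mult.left_commute)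
  then have de_bruijn: "card (de_bruijn_words (d + 1)) * 2 ^ d = 2 ^ (2 ^ d - 1)"
    unfolding power_Suc by simp
  have normal: "card (normal_bases F (2 ^ d)) * 2 ^ d = 2 ^ (2 ^ d - 1)"
    if "field F" "order F = 2 ^ (2 ^ d)" for F :: "('a, 'b) ring_scheme"
    using card_normal_bases[of F e] that unfolding d by blast
  have bij: "\<exists>f. bij_betw f A B"
    if "card A * 2 ^ d = 2 ^ (2 ^ d - 1)" "card B * 2 ^ d = 2 ^ (2 ^ d - 1)"
    for A :: "'x set" and B :: "'y set"
  proof -
    have "card A = card B"
      using that by (metis mult_cancel2 power_not_zero zero_neq_numeral)
    \<comment> \<open>Infinite sets have \<open>card\<close> 0, so nonzero values also yield
      finiteness.\<close>
    moreover have "card A \<noteq> 0" "card B \<noteq> 0"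
      using that by (metis mult_0 power_not_zero zero_neq_numeral)+
    ultimately show ?thesis
      by (intro finite_same_card_bij) (auto intro: card_ge_0_finite)
  qed
  show ?thesis
  proof (intro conjI allI impI)
    show "\<exists>f. bij_betw f (de_bruijn_words (d + 1)) (odd_necklaces (2 ^ d))"
      by (rule bij[OF de_bruijn odd])
    fix F :: "('a, 'b) ring_scheme" assume F: "field F \<and> order F = 2 ^ (2 ^ d)"
    show "\<exists>g. bij_betw g (odd_necklaces (2 ^ d)) (normal_bases F (2 ^ d))"
      by (rule bij[OF odd normal]) (use F in auto)
    show "\<exists>h. bij_betw h (de_bruijn_words (d + 1)) (normal_bases F (2 ^ d))"
      by (rule bij[OF de_bruijn normal]) (use F in auto)
  qed
qed

end
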